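(* Let $f = \sum_{t=1}^s f_t \in \mathcal{C}^{\infty}(\mathbb{R}^n)$ be an additively separable function, i.e. there is a partition $\{x_1,\dots,x_n\}=\bigsqcup_{t=1}^s P_t$ of the variables into non-empty subsets, with $n_t=\#P_t$, such that each $f_t$ is a smooth function of the variables in $P_t$ only (so $f_t\in\mathcal{C}^\infty(\mathbb{R}^{n_t})$). Then $f$ is g-convex with respect to some connection on $\mathbb{R}^n$ if and only if one of the following holds: (a) $f$ has no critical point. (b) For each $1 \le t \le s$, $f_t$ is g-convex with respect to some connection on $\mathbb{R}^{n_t}$. Moreover, if for each $1 \le t \le s$, $f_t$ is g-convex with respect to (the Levi-Civita connection of) some pseudo-Riemannian metric on $\mathbb{R}^{n_t}$, then $f$ is g-convex with respect to some pseudo-Riemannian metric on $\mathbb{R}^n$.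
   Context: A connection means a smooth torsion-free affine connection $\nabla$ ($\nabla_XY-\nabla_YX=[X,Y]$). A smooth function $f$ on a manifold $\mathcal{M}$ is g-convex with respect to $\nabla$ if $f\circ\gamma:[0,1]\to\mathbb{R}$ is convex for every $\nabla$-geodesic $\gamma:[0,1]\to\mathcal{M}$; equivalently, $\mathrm{Hess}_\nabla f(X,Y)=X(Y(f))-(\nabla_XY)(f)$ is positive semidefinite at every point. *)

theory Defs
  imports "HOL-Analysis.Analysis"
begin

text \<open>
  The manifolds are linear subspaces \<open>V\<close> of a Euclidean space; every notion takes \<open>V\<close> as a
  parameter and looks at functions, fields and curves on \<open>V\<close> only. The space \<open>\<real>\<^sup>n\<close> is
  \<open>UNIV :: (real ^ 'n) set\<close>, and \<open>\<real>\<close> to the power \<open>#P\<close>, for a set \<open>P\<close> of variables, is the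
  coordinate subspace \<open>coord_space P\<close> below. So the dimension can depend on a bound variable.
\<close>

definition coord_space :: "'n::finite set \<Rightarrow> (real ^ 'n) set" where
  "coord_space P = {x. \<forall>i. i \<notin> P \<longrightarrow> x $ i = 0}"

definition coord_proj :: "'n::finite set \<Rightarrow> real ^ 'n \<Rightarrow> real ^ 'n" where
  "coord_proj P x = (\<chi> i. if i \<in> P then x $ i else 0)"

subsection \<open>Smooth functions\<close>

primrec Ck_on :: "nat \<Rightarrow> 'a::euclidean_space set \<Rightarrow> ('a \<Rightarrow> 'b::euclidean_space) \<Rightarrow> bool" where
  "Ck_on 0 V f \<longleftrightarrow> continuous_on V f"
| "Ck_on (Suc k) V f \<longleftrightarrow>
     (\<exists>f'. (\<forall>x\<in>V. (f has_derivative f' x) (at x within V)) \<and>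
           (\<forall>v\<in>V. Ck_on k V (\<lambda>x. f' x v)))"

definition smooth_on :: "'a::euclidean_space set \<Rightarrow> ('a \<Rightarrow> 'b::euclidean_space) \<Rightarrow> bool" where
  "smooth_on V f \<longleftrightarrow> (\<forall>k. Ck_on k V f)"

definition critical_point :: "('a::euclidean_space \<Rightarrow> real) \<Rightarrow> 'a \<Rightarrow> bool" where
  "critical_point f x \<longleftrightarrow> (f has_derivative (\<lambda>_. 0)) (at x)"

subsection \<open>Vector fields and connections\<close>

definition vector_fields :: "'a::euclidean_space set \<Rightarrow> ('a \<Rightarrow> 'a) set" where
  "vector_fields V = {X. smooth_on V X \<and> (\<forall>x\<in>V. X x \<in> V)}"

text \<open>
  Derivative of \<open>f\<close> along the vector field \<open>X\<close>. For \<open>x\<close> and \<open>X x\<close> in \<open>V\<close> the line stays in \<open>V\<close>, so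
  only the values of \<open>f\<close> on \<open>V\<close> matter.
\<close>

definition along :: "('a::euclidean_space \<Rightarrow> 'a) \<Rightarrow> ('a \<Rightarrow> 'b::euclidean_space) \<Rightarrow> 'a \<Rightarrow> 'b" where
  "along X f x = vector_derivative (\<lambda>t::real. f (x + t *\<^sub>R X x)) (at 0)"

definition lie_bracket :: "('a::euclidean_space \<Rightarrow> 'a) \<Rightarrow> ('a \<Rightarrow> 'a) \<Rightarrow> 'a \<Rightarrow> 'a" where
  "lie_bracket X Y x = along X Y x - along Y X x"

text \<open>
  Smooth torsion-free affine connections, as operators on vector fields. The value of
  \<open>nabla X Y\<close> on \<open>V\<close> depends only on \<open>X\<close> and \<open>Y\<close> on \<open>V\<close>: take for \<open>h\<close> the indicator function
  of \<open>V\<close>, which is smooth on \<open>V\<close>. Real linearity in the second argument is the Leibniz rule for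
  constant \<open>h\<close>.
\<close>

definition connection ::
  "'a::euclidean_space set \<Rightarrow> (('a \<Rightarrow> 'a) \<Rightarrow> ('a \<Rightarrow> 'a) \<Rightarrow> 'a \<Rightarrow> 'a) \<Rightarrow> bool" where
  "connection V nabla \<longleftrightarrow>
     (\<forall>X\<in>vector_fields V. \<forall>Y\<in>vector_fields V. nabla X Y \<in> vector_fields V) \<and>
     (\<forall>X\<in>vector_fields V. \<forall>X'\<in>vector_fields V. \<forall>Y\<in>vector_fields V. \<forall>x\<in>V.
        nabla (\<lambda>y. X y + X' y) Y x = nabla X Y x + nabla X' Y x) \<and>
     (\<forall>h::'a \<Rightarrow> real. smooth_on V h \<longrightarrow>
        (\<forall>X\<in>vector_fields V. \<forall>Y\<in>vector_fields V. \<forall>x\<in>V.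
           nabla (\<lambda>y. h y *\<^sub>R X y) Y x = h x *\<^sub>R nabla X Y x)) \<and>
     (\<forall>X\<in>vector_fields V. \<forall>Y\<in>vector_fields V. \<forall>Y'\<in>vector_fields V. \<forall>x\<in>V.
        nabla X (\<lambda>y. Y y + Y' y) x = nabla X Y x + nabla X Y' x) \<and>
     (\<forall>h::'a \<Rightarrow> real. smooth_on V h \<longrightarrow>
        (\<forall>X\<in>vector_fields V. \<forall>Y\<in>vector_fields V. \<forall>x\<in>V.
           nabla X (\<lambda>y. h y *\<^sub>R Y y) x = along X h x *\<^sub>R Y x + h x *\<^sub>R nabla X Y x)) \<and>
     (\<forall>X\<in>vector_fields V. \<forall>Y\<in>vector_fields V. \<forall>x\<in>V.
        nabla X Y x - nabla Y X x = lie_bracket X Y x)"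

subsection \<open>Geodesics and g-convexity\<close>

text \<open>
  The Christoffel symbols of \<open>nabla\<close> in the global linear coordinates of \<open>V\<close>, as a bilinear map:
  the covariant derivative of the constant field \<open>v\<close> along the constant field \<open>u\<close>.
\<close>

definition christoffel ::
  "(('a::euclidean_space \<Rightarrow> 'a) \<Rightarrow> ('a \<Rightarrow> 'a) \<Rightarrow> 'a \<Rightarrow> 'a) \<Rightarrow> 'a \<Rightarrow> 'a \<Rightarrow> 'a \<Rightarrow> 'a" where
  "christoffel nabla x u v = nabla (\<lambda>_. u) (\<lambda>_. v) x"

text \<open>
  Solutions on \<open>[0,1]\<close> of the geodesic equation, with \<open>c'\<close> the velocity. They are automatically
  smooth, as the right-hand side is smooth in position and velocity.
\<close>

definition geodesic ::
  "'a::euclidean_space set \<Rightarrow> (('a \<Rightarrow> 'a) \<Rightarrow> ('a \<Rightarrow> 'a) \<Rightarrow> 'a \<Rightarrow> 'a) \<Rightarrow> (real \<Rightarrow> 'a) \<Rightarrow> bool" where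
  "geodesic V nabla c \<longleftrightarrow>
     (\<forall>t\<in>{0..1}. c t \<in> V) \<and>
     (\<exists>c'. \<forall>t\<in>{0..1}.
        (c has_vector_derivative c' t) (at t within {0..1}) \<and>
        (c' has_vector_derivative - christoffel nabla (c t) (c' t) (c' t)) (at t within {0..1}))"

definition g_convex ::
  "'a::euclidean_space set \<Rightarrow> (('a \<Rightarrow> 'a) \<Rightarrow> ('a \<Rightarrow> 'a) \<Rightarrow> 'a \<Rightarrow> 'a) \<Rightarrow> ('a \<Rightarrow> real) \<Rightarrow> bool" where
  "g_convex V nabla f \<longleftrightarrow> (\<forall>c. geodesic V nabla c \<longrightarrow> convex_on {0..1} (f \<circ> c))"

subsection \<open>Pseudo-Riemannian metrics\<close>

text \<open>
  The signature is not mentioned: it is constant by nondegeneracy and continuity, since \<open>V\<close> is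
  connected.
\<close>

definition pseudo_riemannian_metric ::
  "'a::euclidean_space set \<Rightarrow> ('a \<Rightarrow> 'a \<Rightarrow> 'a \<Rightarrow> real) \<Rightarrow> bool" where
  "pseudo_riemannian_metric V g \<longleftrightarrow>
     (\<forall>u\<in>V. \<forall>v\<in>V. smooth_on V (\<lambda>x. g x u v)) \<and>
     (\<forall>x\<in>V. \<forall>u\<in>V. \<forall>v\<in>V. g x u v = g x v u) \<and>
     (\<forall>x\<in>V. \<forall>u\<in>V. \<forall>v\<in>V. \<forall>w\<in>V. g x (u + v) w = g x u w + g x v w) \<and>
     (\<forall>x\<in>V. \<forall>u\<in>V. \<forall>v\<in>V. \<forall>r. g x (r *\<^sub>R u) v = r * g x u v) \<and>
     (\<forall>x\<in>V. \<forall>u\<in>V. (\<forall>v\<in>V. g x u v = 0) \<longrightarrow> u = 0)"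

text \<open>
  A relation and not a function because operators with the same values on \<open>V\<close> for all vector
  fields of \<open>V\<close> may differ elsewhere.
\<close>

definition levi_civita ::
  "'a::euclidean_space set \<Rightarrow> ('a \<Rightarrow> 'a \<Rightarrow> 'a \<Rightarrow> real) \<Rightarrow>
   (('a \<Rightarrow> 'a) \<Rightarrow> ('a \<Rightarrow> 'a) \<Rightarrow> 'a \<Rightarrow> 'a) \<Rightarrow> bool" where
  "levi_civita V g nabla \<longleftrightarrow>
     connection V nabla \<and>
     (\<forall>X\<in>vector_fields V. \<forall>Y\<in>vector_fields V. \<forall>Z\<in>vector_fields V. \<forall>x\<in>V.
        along X (\<lambda>y. g y (Y y) (Z y)) x = g x (nabla X Y x) (Z x) + g x (Y x) (nabla X Z x))"

definition g_convex_connection :: "'a::euclidean_space set \<Rightarrow> ('a \<Rightarrow> real) \<Rightarrow> bool" where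
  "g_convex_connection V f \<longleftrightarrow> (\<exists>nabla. connection V nabla \<and> g_convex V nabla f)"

definition g_convex_metric :: "'a::euclidean_space set \<Rightarrow> ('a \<Rightarrow> real) \<Rightarrow> bool" where
  "g_convex_metric V f \<longleftrightarrow>
     (\<exists>g nabla. pseudo_riemannian_metric V g \<and> levi_civita V g nabla \<and> g_convex V nabla f)"

end

theory Submission
  imports Defs
begin

text \<open>
  A connection amounts to smooth symmetric Christoffel symbols \<open>G\<close>, and since a geodesic leaves
  every point in every direction, \<open>f\<close> is g-convex iff \<open>D f (G v v) \<le> D\<^sup>2 f v v\<close> pointwise. If \<open>f\<close>
  has no critical point, \<open>G = (D\<^sup>2 f / |grad f|\<^sup>2) grad f\<close> turns this into an equality. If \<open>z\<close> is a
  critical point, then on the affine subspace through \<open>z\<close> parallel to the variables of \<open>P t\<close> the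
  differential of \<open>f\<close> is that of \<open>f\<^sub>t\<close> and vanishes in the other directions; so the \<open>P t\<close>-component
  of \<open>G\<close>, restricted to this subspace, makes \<open>f\<^sub>t\<close> g-convex. Conversely the geodesics of a product
  connection project to geodesics of the factors, along which \<open>f\<close> is a sum of convex functions; and
  the product of Levi-Civita connections is the Levi-Civita connection of the product metric.
\<close>

subsection \<open>Smooth functions on subspaces\<close>

lemma Ck_on_cong:
  assumes "\<And>x. x \<in> V \<Longrightarrow> f x = g x"
  shows "Ck_on k V f \<longleftrightarrow> Ck_on k V g"
proof (cases k)
  case 0
  then show ?thesis
    using continuous_on_cong[OF refl assms] by simp
next
  case (Suc l)
  have "(f has_derivative f') (at x within V) \<longleftrightarrow> (g has_derivative f') (at x within V)"
    if "x \<in> V" for x f'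
    using that assms has_derivative_transform[of x V f g f'] has_derivative_transform[of x V g f f']
    by auto
  then show ?thesis
    using Suc by simp
qed

lemma smooth_on_cong:
  "(\<And>x. x \<in> V \<Longrightarrow> f x = g x) \<Longrightarrow> smooth_on V f \<longleftrightarrow> smooth_on V g"
  unfolding smooth_on_def using Ck_on_cong by blast

lemma Ck_on_Suc_imp: "Ck_on (Suc k) V f \<Longrightarrow> Ck_on k V f"
proof (induction k arbitrary: f)
  case 0
  then show ?case
    using has_derivative_continuous_on[of V f] by (simp, metis)
next
  case (Suc k)
  then obtain f' where "\<forall>x\<in>V. (f has_derivative f' x) (at x within V)"
    "\<forall>v\<in>V. Ck_on (Suc k) V (\<lambda>x. f' x v)"
    using Ck_on.simps(2)[of "Suc k"] by blast
  then show ?case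
    using Suc.IH by (simp del: Ck_on.simps(2) add: Ck_on.simps(2)[of k V f]) blast
qed

lemma Ck_on_const: "Ck_on k V (\<lambda>_. c)"
proof (induction k arbitrary: c)
  case (Suc k)
  show ?case
    unfolding Ck_on.simps by (rule exI[of _ "\<lambda>_ _. 0"]) (auto intro: Suc)
qed auto

lemma Ck_on_linear_comp:
  "bounded_linear L \<Longrightarrow> Ck_on k V f \<Longrightarrow> Ck_on k V (\<lambda>x. L (f x))"
proof (induction k arbitrary: f)
  case 0
  then show ?case
    by (auto intro: bounded_linear.continuous_on)
next
  case (Suc k)
  then obtain f' where f': "\<forall>x\<in>V. (f has_derivative f' x) (at x within V)"
    "\<forall>v\<in>V. Ck_on k V (\<lambda>x. f' x v)"
    by auto
  then show ?case
    using Suc.IH[OF Suc.prems(1)]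
    by (auto intro!: exI[of _ "\<lambda>x v. L (f' x v)"] bounded_linear.has_derivative[OF Suc.prems(1)])
qed

lemma Ck_on_add: "Ck_on k V f \<Longrightarrow> Ck_on k V g \<Longrightarrow> Ck_on k V (\<lambda>x. f x + g x)"
proof (induction k arbitrary: f g)
  case 0
  then show ?case
    by (auto intro: continuous_on_add)
next
  case (Suc k)
  then obtain f' g' where f': "\<forall>x\<in>V. (f has_derivative f' x) (at x within V)"
    "\<forall>v\<in>V. Ck_on k V (\<lambda>x. f' x v)"
    and g': "\<forall>x\<in>V. (g has_derivative g' x) (at x within V)"
    "\<forall>v\<in>V. Ck_on k V (\<lambda>x. g' x v)"
    by auto
  then show ?case
    using Suc.IH by (auto intro!: exI[of _ "\<lambda>x v. f' x v + g' x v"] has_derivative_add)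
qed

text \<open>The product rule yields two terms of the same bilinear shape, each pairing a directional
  derivative of order \<open>k\<close> with an undifferentiated factor. That factor is lowered to
  order \<open>k\<close> by \<open>Ck_on_Suc_imp\<close>, so the induction hypothesis covers both
  terms.\<close>

lemma Ck_on_bilinear_comp:
  assumes "bounded_bilinear B"
  shows "Ck_on k V f \<Longrightarrow> Ck_on k V g \<Longrightarrow> Ck_on k V (\<lambda>x. B (f x) (g x))"
proof (induction k arbitrary: f g)
  case 0
  then show ?case
    by (auto intro: bounded_bilinear.continuous_on[OF assms])
next
  case (Suc k)
  then obtain f' g' where f': "\<forall>x\<in>V. (f has_derivative f' x) (at x within V)"
    "\<forall>v\<in>V. Ck_on k V (\<lambda>x. f' x v)"
    and g': "\<forall>x\<in>V. (g has_derivative g' x) (at x within V)"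
    "\<forall>v\<in>V. Ck_on k V (\<lambda>x. g' x v)"
    by auto
  then show ?case
    using Suc.IH Suc.prems[THEN Ck_on_Suc_imp] unfolding Ck_on.simps
    by (intro exI[of _ "\<lambda>x v. B (f x) (g' x v) + B (f' x v) (g x)"]) (auto intro!: Ck_on_add bounded_bilinear.FDERIV[OF assms])
qed

text \<open>The derivative of 1/f is - f'/f^2, a product of \<open>f'\<close> with two copies of the
  inverse itself, which the induction hypothesis already controls to order \<open>k\<close>.\<close>

lemma Ck_on_inverse:
  fixes f :: "'a::euclidean_space \<Rightarrow> real"
  assumes "\<And>x. x \<in> V \<Longrightarrow> f x \<noteq> 0"
  shows "Ck_on k V f \<Longrightarrow> Ck_on k V (\<lambda>x. inverse (f x))"
proof (induction k)
  case 0
  then show ?case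
    using assms by (auto intro: continuous_on_inverse)
next
  case (Suc k)
  then obtain f' where f': "\<forall>x\<in>V. (f has_derivative f' x) (at x within V)"
    "\<forall>v\<in>V. Ck_on k V (\<lambda>x. f' x v)"
    by auto
  have "Ck_on k V (\<lambda>x. - (inverse (f x) * f' x v * inverse (f x)))" if "v \<in> V" for v
    using Suc.IH Suc.prems[THEN Ck_on_Suc_imp] f'(2) that
    by (intro Ck_on_linear_comp[OF bounded_linear_minus[OF bounded_linear_ident]]
        Ck_on_bilinear_comp[OF bounded_bilinear_mult]) auto
  then show ?case
    using f'(1) assms unfolding Ck_on.simps
    by (intro exI[of _ "\<lambda>x v. - (inverse (f x) * f' x v * inverse (f x))"])
      (simp add: has_derivative_inverse)
qed

lemma has_derivative_affine_comp:
  assumes "(f has_derivative f') (at (a + L x) within W)" "bounded_linear L"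
    and "\<And>y. y \<in> V \<Longrightarrow> a + L y \<in> W"
  shows "((\<lambda>x. f (a + L x)) has_derivative (\<lambda>v. f' (L v))) (at x within V)"
proof -
  have "((\<lambda>x. a + L x) has_derivative L) (at x within V)"
    using has_derivative_add[OF has_derivative_const bounded_linear_imp_has_derivative[OF assms(2)]]
    by simp
  then show ?thesis
    by (rule has_derivative_in_compose) (use assms in \<open>auto intro: has_derivative_subset\<close>)
qed

text \<open>Base points and directions are constrained separately: \<open>Ck_on\<close> controls
  derivatives only in directions belonging to the set, so \<open>L\<close> must map \<open>V\<close>
  into \<open>W\<close> even when the translation by \<open>a\<close> leaves the range of
  \<open>L\<close>.\<close>

lemma Ck_on_affine_comp:
  assumes "bounded_linear L" and "L ` V \<subseteq> W" and "\<And>y. y \<in> V \<Longrightarrow> a + L y \<in> W"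
  shows "Ck_on k W f \<Longrightarrow> Ck_on k V (\<lambda>x. f (a + L x))"
proof (induction k arbitrary: f)
  case 0
  have "continuous_on V (\<lambda>x. a + L x)"
    by (intro continuous_on_add continuous_on_const linear_continuous_on assms(1))
  then show ?case
    using 0 assms(3) by (auto intro: continuous_on_compose2)
next
  case (Suc k)
  then obtain f' where f': "\<forall>x\<in>W. (f has_derivative f' x) (at x within W)"
    "\<forall>v\<in>W. Ck_on k W (\<lambda>x. f' x v)"
    by auto
  then have "\<forall>x\<in>V. ((\<lambda>x. f (a + L x)) has_derivative (\<lambda>v. f' (a + L x) (L v))) (at x within V)"
    using has_derivative_affine_comp[OF _ assms(1,3)] assms(3) by blast
  moreover have "\<forall>v\<in>V. Ck_on k V (\<lambda>x. f' (a + L x) (L v))"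
    using Suc.IH f'(2) assms(2) by blast
  ultimately show ?case
    by auto
qed

lemma Ck_on_ident: "Ck_on k V (\<lambda>x. x)"
proof (cases k)
  case (Suc l)
  show ?thesis
    unfolding Suc Ck_on.simps by (rule exI[of _ "\<lambda>_ v. v"]) (auto intro: Ck_on_const)
qed auto

lemma smooth_on_const [simp]: "smooth_on V (\<lambda>_. c)"
  by (simp add: smooth_on_def Ck_on_const)

lemma smooth_on_linear_comp:
  "bounded_linear L \<Longrightarrow> smooth_on V f \<Longrightarrow> smooth_on V (\<lambda>x. L (f x))"
  by (simp add: smooth_on_def Ck_on_linear_comp)

lemma smooth_on_add: "smooth_on V f \<Longrightarrow> smooth_on V g \<Longrightarrow> smooth_on V (\<lambda>x. f x + g x)"
  by (simp add: smooth_on_def Ck_on_add)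

lemma smooth_on_sum:
  "(\<And>i. i \<in> I \<Longrightarrow> smooth_on V (f i)) \<Longrightarrow> smooth_on V (\<lambda>x. \<Sum>i\<in>I. f i x)"
  by (induction I rule: infinite_finite_induct) (auto intro: smooth_on_add)

lemma smooth_on_bilinear_comp:
  "bounded_bilinear B \<Longrightarrow> smooth_on V f \<Longrightarrow> smooth_on V g \<Longrightarrow> smooth_on V (\<lambda>x. B (f x) (g x))"
  by (simp add: smooth_on_def Ck_on_bilinear_comp)

lemmas smooth_on_scaleR = smooth_on_bilinear_comp[OF bounded_bilinear_scaleR]
lemmas smooth_on_mult = smooth_on_bilinear_comp[OF bounded_bilinear_mult[where 'a = real]]
lemmas smooth_on_inner_left = smooth_on_linear_comp[OF bounded_linear_inner_left]

lemma smooth_on_inverse: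
  fixes f :: "'a::euclidean_space \<Rightarrow> real"
  shows "smooth_on V f \<Longrightarrow> (\<And>x. x \<in> V \<Longrightarrow> f x \<noteq> 0) \<Longrightarrow> smooth_on V (\<lambda>x. inverse (f x))"
  by (simp add: smooth_on_def Ck_on_inverse)

lemma smooth_on_affine_comp:
  assumes "smooth_on W f" and "bounded_linear L" and "L ` V \<subseteq> W" and "\<And>y. y \<in> V \<Longrightarrow> a + L y \<in> W"
  shows "smooth_on V (\<lambda>x. f (a + L x))"
  unfolding smooth_on_def
proof
  show "Ck_on k V (\<lambda>x. f (a + L x))" for k
    by (rule Ck_on_affine_comp[OF assms(2-4)]) (use assms(1) in \<open>auto simp: smooth_on_def\<close>)
qed

lemma smooth_on_ident: "smooth_on V (\<lambda>x. x)"
  by (simp add: smooth_on_def Ck_on_ident)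

section \<open>Derivatives within a subspace and along vector fields\<close>

text \<open>A line through \<open>x\<close> in a direction of \<open>V\<close> stays in
  \<open>V\<close> for both signs of \<open>t\<close>, so the derivative within \<open>V\<close>
  gives a two-sided one. This links \<open>has_derivative\<close> with the definition of
  \<open>along\<close>.\<close>

lemma has_derivative_along_line:
  assumes "subspace V" "x \<in> V" "v \<in> V" "(f has_derivative f') (at x within V)"
  shows "((\<lambda>t::real. f (x + t *\<^sub>R v)) has_vector_derivative f' v) (at 0)"
proof -
  have "((\<lambda>t. f (x + t *\<^sub>R v)) has_derivative (\<lambda>t. f' (t *\<^sub>R v))) (at 0 within UNIV)"
    by (rule has_derivative_affine_comp)
      (use assms in \<open>auto intro!: subspace_add subspace_scale bounded_linear_intros\<close>)
  then show ?thesis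
    using has_derivative_bounded_linear[OF assms(4)]
    by (simp add: has_vector_derivative_def linear_simps)
qed

lemma has_derivative_within_subspace_unique:
  assumes "subspace V" "x \<in> V" "v \<in> V"
    and "(f has_derivative f') (at x within V)" "(f has_derivative f'') (at x within V)"
  shows "f' v = f'' v"
  using has_derivative_along_line[OF assms(1-4)] has_derivative_along_line[OF assms(1-3,5)]
  by (rule vector_derivative_unique_at)

text \<open>The definition of \<open>Ck_on\<close> supplies a possibly different derivative for each
  order. They all agree on directions in \<open>V\<close>, so the one chosen for order 0 has smooth
  directional derivatives of every order.\<close>

lemma smooth_on_derivative:
  assumes "subspace V" "smooth_on V f"
  obtains f' where "\<And>x. x \<in> V \<Longrightarrow> (f has_derivative f' x) (at x within V)"
    and "\<And>v. v \<in> V \<Longrightarrow> smooth_on V (\<lambda>x. f' x v)"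
proof -
  have "Ck_on (Suc k) V f" for k
    using assms(2) unfolding smooth_on_def by blast
  then have "\<forall>k. \<exists>f'. (\<forall>x\<in>V. (f has_derivative f' x) (at x within V)) \<and>
      (\<forall>v\<in>V. Ck_on k V (\<lambda>x. f' x v))"
    by simp
  then obtain f' where f': "\<And>k x. x \<in> V \<Longrightarrow> (f has_derivative f' k x) (at x within V)"
    and Ck: "\<And>k v. v \<in> V \<Longrightarrow> Ck_on k V (\<lambda>x. f' k x v)"
    by metis
  have "Ck_on k V (\<lambda>x. f' 0 x v)" if "v \<in> V" for k v
    using Ck_on_cong[of V "\<lambda>x. f' 0 x v" "\<lambda>x. f' k x v"]
      has_derivative_within_subspace_unique[OF assms(1) _ that f' f'] Ck[OF that] by simp
  then show ?thesis
    using that f' unfolding smooth_on_def by blast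
qed

lemma smooth_on_imp_continuous_on: "smooth_on V f \<Longrightarrow> continuous_on V f"
  unfolding smooth_on_def by (metis Ck_on.simps(1))

lemma subspace_orthonormal_expansion:
  fixes V :: "'a::euclidean_space set"
  assumes "subspace V"
  obtains B where "finite B" "B \<subseteq> V" "\<And>x. x \<in> V \<Longrightarrow> (\<Sum>b\<in>B. (x \<bullet> b) *\<^sub>R b) = x"
proof -
  obtain B where B: "B \<subseteq> V" "pairwise orthogonal B" "\<And>x. x \<in> B \<Longrightarrow> norm x = 1"
    "independent B" "span B = V"
    using orthonormal_basis_subspace[OF assms] by metis
  then have "finite B"
    using independent_imp_finite by blast
  then show ?thesis
    using B orthonormal_basis_expand[OF B(2,3)] that by blast
qed

text \<open>The orthogonal projection onto \<open>V\<close> fixes the curve; being linear, it fixes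
  its derivative too, by uniqueness of derivatives.\<close>

lemma vector_derivative_in_subspace:
  fixes c :: "real \<Rightarrow> 'a::euclidean_space"
  assumes "subspace V" "(c has_vector_derivative w) (at 0)" "\<And>t. c t \<in> V"
  shows "w \<in> V"
proof -
  obtain B where B: "finite B" "B \<subseteq> V" "\<And>x. x \<in> V \<Longrightarrow> (\<Sum>b\<in>B. (x \<bullet> b) *\<^sub>R b) = x"
    using subspace_orthonormal_expansion[OF assms(1)] by blast
  let ?p = "\<lambda>x. \<Sum>b\<in>B. (x \<bullet> b) *\<^sub>R b"
  have "bounded_linear ?p"
    by (intro bounded_linear_intros)
  from bounded_linear.has_vector_derivative[OF this assms(2)]
  have "(c has_vector_derivative ?p w) (at 0)"
    using B(3) assms(3) by simp
  then have "w = ?p w"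
    using assms(2) vector_derivative_unique_at by blast
  moreover have "?p w \<in> V"
    using B(2) by (auto intro!: subspace_sum[OF assms(1)] subspace_scale[OF assms(1)])
  ultimately show ?thesis
    by simp
qed

lemma along_eq:
  assumes "subspace V" "x \<in> V" "X x \<in> V" "(f has_derivative f') (at x within V)"
  shows "along X f x = f' (X x)"
  unfolding along_def by (rule vector_derivative_at[OF has_derivative_along_line[OF assms]])

lemma along_const [simp]: "along X (\<lambda>_. c) x = 0"
  by (simp add: along_def)

text \<open>Expanding \<open>X x\<close> in an orthonormal basis turns the derivative into a sum of
  smooth coefficients times derivatives in fixed directions. The basis is one of \<open>V\<close>,
  since \<open>f' x b\<close> is known to be smooth only for \<open>b\<close> in
  \<open>V\<close>.\<close>

lemma smooth_on_along:
  assumes "subspace V" "X \<in> vector_fields V" "smooth_on V f"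
  shows "smooth_on V (along X f)"
proof -
  obtain f' where f': "\<And>x. x \<in> V \<Longrightarrow> (f has_derivative f' x) (at x within V)"
    "\<And>v. v \<in> V \<Longrightarrow> smooth_on V (\<lambda>x. f' x v)"
    using smooth_on_derivative[OF assms(1,3)] by blast
  obtain B where B: "finite B" "B \<subseteq> V" "\<And>x. x \<in> V \<Longrightarrow> (\<Sum>b\<in>B. (x \<bullet> b) *\<^sub>R b) = x"
    using subspace_orthonormal_expansion[OF assms(1)] by blast
  have "along X f x = (\<Sum>b\<in>B. (X x \<bullet> b) *\<^sub>R f' x b)" if "x \<in> V" for x
  proof -
    have Xx: "X x \<in> V"
      using assms(2) that by (simp add: vector_fields_def)
    have "along X f x = f' x (\<Sum>b\<in>B. (X x \<bullet> b) *\<^sub>R b)"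
      using along_eq[of V x X, OF assms(1) that Xx f'(1)[OF that]] B(3)[OF Xx] by simp
    also have "\<dots> = (\<Sum>b\<in>B. (X x \<bullet> b) *\<^sub>R f' x b)"
      using has_derivative_linear[OF f'(1)[OF that]] by (simp add: linear_sum linear_scale)
    finally show ?thesis .
  qed
  moreover have "smooth_on V (\<lambda>x. \<Sum>b\<in>B. (X x \<bullet> b) *\<^sub>R f' x b)"
    using assms(2) f'(2) B(2)
    by (intro smooth_on_sum smooth_on_scaleR smooth_on_inner_left) (auto simp: vector_fields_def)
  ultimately show ?thesis
    using smooth_on_cong[of V "along X f"] by simp
qed

lemma along_in_subspace:
  assumes "subspace V" "X \<in> vector_fields V" "Y \<in> vector_fields V" "x \<in> V"
  shows "along X Y x \<in> V"
proof -
  have sm: "smooth_on V Y" and Xx: "X x \<in> V"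
    using assms by (simp_all add: vector_fields_def)
  from sm obtain f' where f': "(Y has_derivative f') (at x within V)"
    using smooth_on_derivative[OF assms(1)] assms(4) by metis
  have "((\<lambda>t. Y (x + t *\<^sub>R X x)) has_vector_derivative along X Y x) (at 0)"
    using has_derivative_along_line[OF assms(1,4) Xx f'] along_eq[of V x X Y, OF assms(1,4) Xx f'] by simp
  moreover have "Y (x + t *\<^sub>R X x) \<in> V" for t
    using assms Xx by (auto simp: vector_fields_def intro!: subspace_add subspace_scale)
  ultimately show ?thesis
    using vector_derivative_in_subspace[OF assms(1)] by blast
qed

section \<open>Linear and bilinear maps in coordinates\<close>

lemma linear_basis_expand:
  fixes h :: "'a::euclidean_space \<Rightarrow> 'b::real_vector"
  assumes "linear h"
  shows "h v = (\<Sum>b\<in>Basis. (v \<bullet> b) *\<^sub>R h b)"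
proof -
  have "h v = h (\<Sum>b\<in>Basis. (v \<bullet> b) *\<^sub>R b)"
    by (simp add: euclidean_representation)
  then show ?thesis
    by (simp add: linear_sum[OF assms] linear_scale[OF assms])
qed

lemma bilinear_basis_expand:
  fixes h :: "'a::euclidean_space \<Rightarrow> 'a \<Rightarrow> 'b::real_vector"
  assumes "bilinear h"
  shows "h u v = (\<Sum>b\<in>Basis. \<Sum>c\<in>Basis. ((u \<bullet> b) * (v \<bullet> c)) *\<^sub>R h b c)"
proof -
  have "h u v = h (\<Sum>b\<in>Basis. (u \<bullet> b) *\<^sub>R b) (\<Sum>c\<in>Basis. (v \<bullet> c) *\<^sub>R c)"
    by (simp add: euclidean_representation)
  also have "\<dots> = (\<Sum>b\<in>Basis. \<Sum>c\<in>Basis. ((u \<bullet> b) * (v \<bullet> c)) *\<^sub>R h b c)"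
    by (simp add: bilinear_sum[OF assms] bilinear_lmul[OF assms] bilinear_rmul[OF assms]
        sum.cartesian_product case_prod_unfold mult.commute)
  finally show ?thesis .
qed

lemma smooth_on_bilinear_apply:
  fixes G :: "'a::euclidean_space \<Rightarrow> 'a \<Rightarrow> 'a \<Rightarrow> 'b::euclidean_space"
  assumes "\<And>x. x \<in> V \<Longrightarrow> bilinear (G x)" "\<And>u v. smooth_on V (\<lambda>x. G x u v)"
    and "smooth_on V X" "smooth_on V Y"
  shows "smooth_on V (\<lambda>x. G x (X x) (Y x))"
proof -
  have "smooth_on V (\<lambda>x. \<Sum>b\<in>Basis. \<Sum>c\<in>Basis. ((X x \<bullet> b) * (Y x \<bullet> c)) *\<^sub>R G x b c)"
    by (intro smooth_on_sum smooth_on_scaleR smooth_on_mult smooth_on_inner_left assms)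
  moreover have "smooth_on V (\<lambda>x. G x (X x) (Y x)) \<longleftrightarrow>
      smooth_on V (\<lambda>x. \<Sum>b\<in>Basis. \<Sum>c\<in>Basis. ((X x \<bullet> b) * (Y x \<bullet> c)) *\<^sub>R G x b c)"
    by (rule smooth_on_cong) (rule bilinear_basis_expand[OF assms(1)])
  ultimately show ?thesis
    by simp
qed

text \<open>Product rule for three moving objects: the double sum differentiates the coefficients of
  \<open>G\<close> with frozen arguments, and the other two terms differentiate the arguments with
  frozen \<open>G\<close>.\<close>

lemma has_derivative_bilinear_apply:
  fixes G :: "'a::euclidean_space \<Rightarrow> 'a \<Rightarrow> 'a \<Rightarrow> 'b::euclidean_space"
  assumes G: "\<And>y. y \<in> V \<Longrightarrow> bilinear (G y)" and x: "x \<in> V"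
    and G': "\<And>u v. ((\<lambda>y. G y u v) has_derivative G' u v) (at x within V)"
    and X: "(X has_derivative X') (at x within V)" and Y: "(Y has_derivative Y') (at x within V)"
  shows "((\<lambda>y. G y (X y) (Y y)) has_derivative
    (\<lambda>h. (\<Sum>b\<in>Basis. \<Sum>c\<in>Basis. ((X x \<bullet> b) * (Y x \<bullet> c)) *\<^sub>R G' b c h) +
      (G x (X' h) (Y x) + G x (X x) (Y' h)))) (at x within V)"
proof -
  let ?D = "\<lambda>h. \<Sum>b\<in>Basis. \<Sum>c\<in>Basis. ((X x \<bullet> b) * (Y x \<bullet> c)) *\<^sub>R G' b c h +
      ((X x \<bullet> b) * (Y' h \<bullet> c) + (X' h \<bullet> b) * (Y x \<bullet> c)) *\<^sub>R G x b c"
  have "((\<lambda>y. \<Sum>b\<in>Basis. \<Sum>c\<in>Basis. ((X y \<bullet> b) * (Y y \<bullet> c)) *\<^sub>R G y b c) has_derivative ?D)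
      (at x within V)"
    by (intro has_derivative_sum has_derivative_scaleR has_derivative_mult
        has_derivative_inner_left X Y G')
  then have "((\<lambda>y. G y (X y) (Y y)) has_derivative ?D) (at x within V)"
    by (rule has_derivative_transform[OF x, rotated]) (rule bilinear_basis_expand[OF G])
  moreover note e = bilinear_basis_expand[OF G[OF x], of "X' _" "Y x"]
    bilinear_basis_expand[OF G[OF x], of "X x" "Y' _"]
  have "?D = (\<lambda>h. (\<Sum>b\<in>Basis. \<Sum>c\<in>Basis. ((X x \<bullet> b) * (Y x \<bullet> c)) *\<^sub>R G' b c h) +
      (G x (X' h) (Y x) + G x (X x) (Y' h)))"
    by (rule ext) (simp add: e sum.distrib scaleR_left_distrib add.commute)
  ultimately show ?thesis
    by simp
qed

subsection \<open>Connections and Christoffel symbols\<close>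

text \<open>The flat connection \<open>along\<close> of the linear space, modified by the tensor
  \<open>G\<close>.\<close>

definition christoffel_connection ::
  "('a::euclidean_space \<Rightarrow> 'a \<Rightarrow> 'a \<Rightarrow> 'a) \<Rightarrow> ('a \<Rightarrow> 'a) \<Rightarrow> ('a \<Rightarrow> 'a) \<Rightarrow> 'a \<Rightarrow> 'a" where
  "christoffel_connection G X Y x = along X Y x + G x (X x) (Y x)"

text \<open>Bilinearity, smoothness and symmetry range over all ambient vectors, so that
  \<open>G x\<close> can be expanded in \<open>Basis\<close>; only the last clause is about vectors
  of \<open>V\<close>. Symmetry expresses that the torsion vanishes.\<close>

definition christoffel_symbols ::
  "'a::euclidean_space set \<Rightarrow> ('a \<Rightarrow> 'a \<Rightarrow> 'a \<Rightarrow> 'a) \<Rightarrow> bool" where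
  "christoffel_symbols V G \<longleftrightarrow>
     (\<forall>x\<in>V. bilinear (G x)) \<and> (\<forall>u v. smooth_on V (\<lambda>x. G x u v)) \<and>
     (\<forall>x\<in>V. \<forall>u v. G x u v = G x v u) \<and> (\<forall>x\<in>V. \<forall>u\<in>V. \<forall>v\<in>V. G x u v \<in> V)"

lemma christoffel_christoffel_connection [simp]: "christoffel (christoffel_connection G) = G"
  by (simp add: christoffel_def christoffel_connection_def fun_eq_iff)

lemma const_in_vector_fields [simp]: "u \<in> V \<Longrightarrow> (\<lambda>_. u) \<in> vector_fields V"
  by (simp add: vector_fields_def)

text \<open>Linearity of the derivative and the Leibniz rule give the axioms for
  \<open>along\<close>; the \<open>G\<close> term is linear over functions in both arguments and, by
  symmetry, cancels from the torsion.\<close>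

lemma connection_christoffel_connection:
  assumes V: "subspace V" and G: "christoffel_symbols V G"
  shows "connection V (christoffel_connection G)"
proof -
  have bil: "\<And>x. x \<in> V \<Longrightarrow> bilinear (G x)" and sm: "\<And>u v. smooth_on V (\<lambda>x. G x u v)"
    and sym: "\<And>x u v. x \<in> V \<Longrightarrow> G x u v = G x v u"
    and cl: "\<And>x u v. x \<in> V \<Longrightarrow> u \<in> V \<Longrightarrow> v \<in> V \<Longrightarrow> G x u v \<in> V"
    using G by (auto simp: christoffel_symbols_def)
  have diff: "\<exists>f'. (f has_derivative f') (at x within V)" if "smooth_on V f" "x \<in> V"
    for f :: "'a \<Rightarrow> 'b::euclidean_space" and x
    using smooth_on_derivative[OF V that(1)] that(2) by metis
  have diffV: "\<exists>f'. (Y has_derivative f') (at x within V)" if "Y \<in> vector_fields V" "x \<in> V" for Y x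
    using that by (intro diff) (auto simp: vector_fields_def)
  show ?thesis
    unfolding connection_def
  proof (intro conjI ballI allI impI)
    fix X Y assume X: "X \<in> vector_fields V" and Y: "Y \<in> vector_fields V"
    have XY: "smooth_on V X" "smooth_on V Y"
      using X Y by (auto simp: vector_fields_def)
    have "smooth_on V (\<lambda>x. along X Y x + G x (X x) (Y x))"
      by (rule smooth_on_add[OF smooth_on_along[OF V X XY(2)] smooth_on_bilinear_apply[OF bil sm XY]])
    moreover have "along X Y x + G x (X x) (Y x) \<in> V" if "x \<in> V" for x
      using that X Y
      by (intro subspace_add V along_in_subspace[OF V X Y] cl) (auto simp: vector_fields_def)
    ultimately show "christoffel_connection G X Y \<in> vector_fields V"
      by (simp add: vector_fields_def christoffel_connection_def[abs_def])
  next
    fix X X' Y x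
    assume H: "X \<in> vector_fields V" "X' \<in> vector_fields V" "Y \<in> vector_fields V" "x \<in> V"
    obtain Y' where Y': "(Y has_derivative Y') (at x within V)"
      using diffV[OF H(3,4)] by blast
    have XV: "X x \<in> V" and XV': "X' x \<in> V"
      using H by (simp_all add: vector_fields_def)
    have "along (\<lambda>y. X y + X' y) Y x = Y' (X x + X' x)"
      by (rule along_eq[OF V \<open>x \<in> V\<close> _ Y']) (rule subspace_add[OF V XV XV'])
    then show "christoffel_connection G (\<lambda>y. X y + X' y) Y x =
        christoffel_connection G X Y x + christoffel_connection G X' Y x"
      using along_eq[of V x X, OF V \<open>x \<in> V\<close> XV Y'] along_eq[of V x X', OF V \<open>x \<in> V\<close> XV' Y'] H
      by (simp add: christoffel_connection_def bilinear_ladd[OF bil]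
          linear_add[OF has_derivative_linear[OF Y']])
  next
    fix h :: "'a \<Rightarrow> real" and X Y x
    assume H: "smooth_on V h" "X \<in> vector_fields V" "Y \<in> vector_fields V" "x \<in> V"
    obtain Y' where Y': "(Y has_derivative Y') (at x within V)"
      using diffV[OF H(3,4)] by blast
    have XV: "X x \<in> V"
      using H by (simp add: vector_fields_def)
    have "along (\<lambda>y. h y *\<^sub>R X y) Y x = Y' (h x *\<^sub>R X x)"
      by (rule along_eq[OF V \<open>x \<in> V\<close> _ Y']) (rule subspace_scale[OF V XV])
    then show "christoffel_connection G (\<lambda>y. h y *\<^sub>R X y) Y x = h x *\<^sub>R christoffel_connection G X Y x"
      using along_eq[of V x X, OF V \<open>x \<in> V\<close> XV Y'] H
      by (simp add: christoffel_connection_def bilinear_lmul[OF bil] scaleR_right_distrib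
          linear_scale[OF has_derivative_linear[OF Y']])
  next
    fix X Y Y' x
    assume H: "X \<in> vector_fields V" "Y \<in> vector_fields V" "Y' \<in> vector_fields V" "x \<in> V"
    obtain D D' where D: "(Y has_derivative D) (at x within V)" "(Y' has_derivative D') (at x within V)"
      using diffV[OF H(2,4)] diffV[OF H(3,4)] by blast
    have XV: "X x \<in> V"
      using H by (simp add: vector_fields_def)
    show "christoffel_connection G X (\<lambda>y. Y y + Y' y) x =
        christoffel_connection G X Y x + christoffel_connection G X Y' x"
      using along_eq[of V x X, OF V \<open>x \<in> V\<close> XV D(1)] along_eq[of V x X, OF V \<open>x \<in> V\<close> XV D(2)] H
        along_eq[of V x X, OF V \<open>x \<in> V\<close> XV has_derivative_add[OF D]]
      by (simp add: christoffel_connection_def bilinear_radd[OF bil])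
  next
    fix h :: "'a \<Rightarrow> real" and X Y x
    assume H: "smooth_on V h" "X \<in> vector_fields V" "Y \<in> vector_fields V" "x \<in> V"
    obtain D h' where D: "(Y has_derivative D) (at x within V)" "(h has_derivative h') (at x within V)"
      using diffV[OF H(3,4)] diff[OF H(1,4)] by blast
    have XV: "X x \<in> V"
      using H by (simp add: vector_fields_def)
    show "christoffel_connection G X (\<lambda>y. h y *\<^sub>R Y y) x =
        along X h x *\<^sub>R Y x + h x *\<^sub>R christoffel_connection G X Y x"
      using along_eq[of V x X, OF V \<open>x \<in> V\<close> XV D(1)] along_eq[of V x X, OF V \<open>x \<in> V\<close> XV D(2)] H
        along_eq[of V x X, OF V \<open>x \<in> V\<close> XV has_derivative_scaleR[OF D(2,1)]]
      by (simp add: christoffel_connection_def bilinear_rmul[OF bil] algebra_simps)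
  next
    fix X Y x
    assume H: "X \<in> vector_fields V" "Y \<in> vector_fields V" "x \<in> V"
    then show "christoffel_connection G X Y x - christoffel_connection G Y X x = lie_bracket X Y x"
      using sym[of x "X x" "Y x"] by (simp add: christoffel_connection_def lie_bracket_def)
  qed
qed

text \<open>These are the connection axioms for constant fields, with constant \<open>h\<close> for
  homogeneity. Constant fields have zero Lie bracket, so vanishing torsion becomes symmetry.\<close>

lemma connection_christoffel:
  assumes V: "subspace V" and nabla: "connection V nabla"
  shows "\<And>u v. u \<in> V \<Longrightarrow> v \<in> V \<Longrightarrow> (\<lambda>x. christoffel nabla x u v) \<in> vector_fields V"
    and "\<And>u u' v x. u \<in> V \<Longrightarrow> u' \<in> V \<Longrightarrow> v \<in> V \<Longrightarrow> x \<in> V \<Longrightarrow>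
      christoffel nabla x (u + u') v = christoffel nabla x u v + christoffel nabla x u' v"
    and "\<And>r u v x. u \<in> V \<Longrightarrow> v \<in> V \<Longrightarrow> x \<in> V \<Longrightarrow>
      christoffel nabla x (r *\<^sub>R u) v = r *\<^sub>R christoffel nabla x u v"
    and "\<And>u v x. u \<in> V \<Longrightarrow> v \<in> V \<Longrightarrow> x \<in> V \<Longrightarrow> christoffel nabla x u v = christoffel nabla x v u"
proof -
  fix u v assume "u \<in> V" "v \<in> V"
  then have "nabla (\<lambda>_. u) (\<lambda>_. v) \<in> vector_fields V"
    using nabla by (simp add: connection_def)
  then show "(\<lambda>x. christoffel nabla x u v) \<in> vector_fields V"
    by (simp add: christoffel_def)
next
  fix u u' v x assume H: "u \<in> V" "u' \<in> V" "v \<in> V" "x \<in> V"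
  have "\<forall>X\<in>vector_fields V. \<forall>X'\<in>vector_fields V. \<forall>Y\<in>vector_fields V. \<forall>x\<in>V.
        nabla (\<lambda>y. X y + X' y) Y x = nabla X Y x + nabla X' Y x"
    using nabla by (simp add: connection_def)
  from bspec[OF bspec[OF bspec[OF bspec[OF this, of "\<lambda>_. u"], of "\<lambda>_. u'"], of "\<lambda>_. v"], of x]
  show "christoffel nabla x (u + u') v = christoffel nabla x u v + christoffel nabla x u' v"
    using H by (simp add: christoffel_def)
next
  fix r u v x assume H: "u \<in> V" "v \<in> V" "x \<in> V"
  have "\<forall>h::'a \<Rightarrow> real. smooth_on V h \<longrightarrow>
        (\<forall>X\<in>vector_fields V. \<forall>Y\<in>vector_fields V. \<forall>x\<in>V.
           nabla (\<lambda>y. h y *\<^sub>R X y) Y x = h x *\<^sub>R nabla X Y x)"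
    using nabla by (simp add: connection_def)
  from bspec[OF bspec[OF bspec[OF mp[OF spec[OF this, of "\<lambda>_. r"]], of "\<lambda>_. u"], of "\<lambda>_. v"], of x]
  show "christoffel nabla x (r *\<^sub>R u) v = r *\<^sub>R christoffel nabla x u v"
    using H by (simp add: christoffel_def)
next
  fix u v x assume H: "u \<in> V" "v \<in> V" "x \<in> V"
  have "\<forall>X\<in>vector_fields V. \<forall>Y\<in>vector_fields V. \<forall>x\<in>V.
        nabla X Y x - nabla Y X x = lie_bracket X Y x"
    using nabla by (simp add: connection_def)
  from bspec[OF bspec[OF bspec[OF this, of "\<lambda>_. u"], of "\<lambda>_. v"], of x]
  show "christoffel nabla x u v = christoffel nabla x v u"
    using H by (simp add: christoffel_def lie_bracket_def)
qed

text \<open>A connection on \<open>V\<close> says nothing about vectors outside \<open>V\<close>.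
  Composing with a linear \<open>p\<close> into \<open>V\<close> extends its symbols bilinearly to
  the ambient space; \<open>p\<close> will be a projection, or the identity when \<open>V\<close> is
  everything.\<close>

lemma christoffel_symbols_pullback:
  assumes V: "subspace V" and nabla: "connection V nabla"
    and p: "bounded_linear p" "range p \<subseteq> V"
  shows "christoffel_symbols V (\<lambda>x u v. christoffel nabla x (p u) (p v))"
proof -
  note C = connection_christoffel[OF V nabla]
  note pl = bounded_linear.linear[OF p(1)]
  have pV: "p u \<in> V" for u
    using p(2) by auto
  have "linear (\<lambda>u. christoffel nabla x (p u) (p v))" if "x \<in> V" for x v
    by (rule linearI) (simp_all add: C that pV linear_add[OF pl] linear_scale[OF pl])
  \<comment> \<open>Symmetry transfers linearity from the first argument to the second.\<close>
  moreover have "linear (\<lambda>v. christoffel nabla x (p u) (p v))" if "x \<in> V" for x u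
    by (subst C(4)[OF pV pV that], rule linearI)
      (simp_all add: C(2,3) pV that linear_add[OF pl] linear_scale[OF pl])
  ultimately have "bilinear (\<lambda>u v. christoffel nabla x (p u) (p v))" if "x \<in> V" for x
    unfolding bilinear_def using that by blast
  moreover have "christoffel nabla x (p u) (p v) \<in> V" if "x \<in> V" for x u v
    using C(1)[OF pV pV] that by (simp add: vector_fields_def)
  ultimately show ?thesis
    using C(1)[OF pV pV] C(4)[OF pV pV] by (simp add: christoffel_symbols_def vector_fields_def)
qed

subsection \<open>The Hessian inequality\<close>

text \<open>By the mean value theorem \<open>h'\<close> is monotone, hence the graph lies above its
  tangents, and this implies convexity. Derivatives within the interval are one-sided at the
  endpoints, as in the definition of \<open>geodesic\<close>.\<close>

lemma convex_on_Icc_nonneg_second_derivative: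
  fixes h h' h'' :: "real \<Rightarrow> real"
  assumes h: "\<And>t. t \<in> {a..b} \<Longrightarrow> (h has_vector_derivative h' t) (at t within {a..b})"
    and h': "\<And>t. t \<in> {a..b} \<Longrightarrow> (h' has_vector_derivative h'' t) (at t within {a..b})"
    and nonneg: "\<And>t. t \<in> {a..b} \<Longrightarrow> 0 \<le> h'' t"
  shows "convex_on {a..b} h"
proof -
  have mvt: "\<exists>\<xi>\<in>{x..y}. k y - k x = (y - x) * k' \<xi>"
    if "\<And>t. t \<in> {a..b} \<Longrightarrow> (k has_vector_derivative k' t) (at t within {a..b})"
      and "x \<in> {a..b}" "y \<in> {a..b}" "x \<le> y" for k k' :: "real \<Rightarrow> real" and x y
    using mvt_very_simple[OF that(4), of k "\<lambda>t s. s * k' t"] that(2,3)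
      has_derivative_subset[OF that(1)[unfolded has_vector_derivative_def], of _ "{x..y}"]
    by auto
  have mono: "h' x \<le> h' y" if xy: "x \<in> {a..b}" "y \<in> {a..b}" "x \<le> y" for x y
  proof -
    obtain \<xi> where \<xi>: "\<xi> \<in> {x..y}" "h' y - h' x = (y - x) * h'' \<xi>"
      using mvt[OF h' xy] by blast
    moreover have "0 \<le> (y - x) * h'' \<xi>"
      using \<xi>(1) nonneg[of \<xi>] xy by (intro mult_nonneg_nonneg) auto
    ultimately show ?thesis
      by simp
  qed
  have tangent: "h z + h' z * (x - z) \<le> h x" if xz: "x \<in> {a..b}" "z \<in> {a..b}" for x z
  proof (cases "z \<le> x")
    case True
    then obtain \<xi> where \<xi>: "\<xi> \<in> {z..x}" "h x - h z = (x - z) * h' \<xi>"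
      using mvt[OF h xz(2,1)] by blast
    then have "(x - z) * h' z \<le> (x - z) * h' \<xi>"
      using mono[of z \<xi>] xz True by (intro mult_left_mono) auto
    then show ?thesis
      using \<xi> by (simp add: mult.commute)
  next
    case False
    then obtain \<xi> where \<xi>: "\<xi> \<in> {x..z}" "h z - h x = (z - x) * h' \<xi>"
      using mvt[OF h xz] by force
    then have "(z - x) * h' \<xi> \<le> (z - x) * h' z"
      using mono[of \<xi> z] xz False by (intro mult_left_mono) auto
    then show ?thesis
      using \<xi> by (simp add: algebra_simps)
  qed
  show ?thesis
  proof (rule convex_onI)
    fix t x y :: real
    assume t: "0 < t" "t < 1" and xy: "x \<in> {a..b}" "y \<in> {a..b}"
    define z where "z = (1 - t) *\<^sub>R x + t *\<^sub>R y"
    have z: "z \<in> {a..b}"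
      unfolding z_def using convexD_alt[OF convex_real_interval(5) xy] t by simp
    \<comment> \<open>The slope terms of the tangent at \<open>z\<close>, weighted by
      \<open>1 - t\<close> and \<open>t\<close>, cancel because \<open>z\<close> is the weighted
      mean of \<open>x\<close> and \<open>y\<close>.\<close>
    have "h z = (1 - t) * (h z + h' z * (x - z)) + t * (h z + h' z * (y - z))"
      by (simp add: z_def algebra_simps)
    also have "\<dots> \<le> (1 - t) * h x + t * h y"
      using tangent[OF xy(1) z] tangent[OF xy(2) z] t by (intro add_mono mult_left_mono) auto
    finally show "h ((1 - t) *\<^sub>R x + t *\<^sub>R y) \<le> (1 - t) * h x + t * h y"
      by (simp add: z_def)
  qed simp
qed

text \<open>\<open>H x v w\<close> differentiates first along \<open>v\<close>, then along
  \<open>w\<close>. It is bilinear on the ambient space, so that coordinates of \<open>Basis\<close>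
  may be used even on a proper subspace.\<close>

definition second_order_derivatives :: "'a::euclidean_space set \<Rightarrow> ('a \<Rightarrow> real) \<Rightarrow>
    ('a \<Rightarrow> 'a \<Rightarrow> real) \<Rightarrow> ('a \<Rightarrow> 'a \<Rightarrow> 'a \<Rightarrow> real) \<Rightarrow> bool" where
  "second_order_derivatives V f D H \<longleftrightarrow>
     (\<forall>x\<in>V. (f has_derivative D x) (at x within V) \<and> bilinear (H x) \<and>
       (\<forall>v. ((\<lambda>y. D y v) has_derivative H x v) (at x within V)))"

text \<open>The chain rule twice. Writing \<open>D (c s) (c' s)\<close> in coordinates of
  \<open>c' s\<close> makes it a sum of ordinary products, with one factor differentiated through
  \<open>H\<close> and the other through \<open>c2\<close>.\<close>

lemma second_order_derivatives_along_curve: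
  assumes D: "second_order_derivatives V f D H"
    and c: "c ` S \<subseteq> V" "t \<in> S"
      "(c has_vector_derivative c' t) (at t within S)"
      "(c' has_vector_derivative c2) (at t within S)"
  shows "((f \<circ> c) has_vector_derivative D (c t) (c' t)) (at t within S)"
    and "((\<lambda>t. D (c t) (c' t)) has_vector_derivative H (c t) (c' t) (c' t) + D (c t) c2)
      (at t within S)"
proof -
  have x: "c t \<in> V"
    using c by auto
  have fD: "\<And>x. x \<in> V \<Longrightarrow> (f has_derivative D x) (at x within V)" and bil: "bilinear (H (c t))"
    and DH: "\<And>v. ((\<lambda>y. D y v) has_derivative H (c t) v) (at (c t) within V)"
    using D x by (auto simp: second_order_derivatives_def)
  note lin = has_derivative_linear[OF fD]
  note Hlin = has_derivative_linear[OF DH]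
  have cd: "(c has_derivative (\<lambda>r. r *\<^sub>R c' t)) (at t within S)"
    and cd': "(c' has_derivative (\<lambda>r. r *\<^sub>R c2)) (at t within S)"
    using c by (simp_all add: has_vector_derivative_def)
  show "((f \<circ> c) has_vector_derivative D (c t) (c' t)) (at t within S)"
    using has_derivative_in_compose[OF cd has_derivative_subset[OF fD[OF x] c(1)]]
    by (simp add: has_vector_derivative_def o_def linear_scale[OF lin[OF x]])
  have expand: "D x v = (\<Sum>b\<in>Basis. (v \<bullet> b) * D x b)" if "x \<in> V" for x v
    using linear_basis_expand[OF lin[OF that], of v] by simp
  have Hexpand: "H (c t) v v = (\<Sum>b\<in>Basis. (v \<bullet> b) * H (c t) b v)" for v
    using linear_basis_expand[of "\<lambda>u. H (c t) u v" v] bil by (simp add: bilinear_def)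
  have "((\<lambda>s. \<Sum>b\<in>Basis. (c' s \<bullet> b) * D (c s) b) has_derivative
      (\<lambda>r. \<Sum>b\<in>Basis. (c' t \<bullet> b) * H (c t) b (r *\<^sub>R c' t) + ((r *\<^sub>R c2) \<bullet> b) * D (c t) b)) (at t within S)"
    by (intro has_derivative_sum has_derivative_mult has_derivative_inner_left cd'
        has_derivative_in_compose[OF cd has_derivative_subset[OF DH c(1)]])
  moreover have "(\<lambda>r. \<Sum>b\<in>Basis. (c' t \<bullet> b) * H (c t) b (r *\<^sub>R c' t) + ((r *\<^sub>R c2) \<bullet> b) * D (c t) b) =
      (\<lambda>r. r *\<^sub>R (H (c t) (c' t) (c' t) + D (c t) c2))"
    by (subst Hexpand, subst expand[OF x, of c2])
      (simp add: linear_scale[OF Hlin] sum.distrib sum_distrib_left algebra_simps)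
  ultimately have "((\<lambda>s. \<Sum>b\<in>Basis. (c' s \<bullet> b) * D (c s) b) has_vector_derivative
      H (c t) (c' t) (c' t) + D (c t) c2) (at t within S)"
    by (simp add: has_vector_derivative_def)
  then show "((\<lambda>t. D (c t) (c' t)) has_vector_derivative H (c t) (c' t) (c' t) + D (c t) c2)
      (at t within S)"
    by (rule has_vector_derivative_transform[OF c(2), rotated]) (use expand c(1) in auto)
qed

text \<open>On a geodesic the acceleration is minus the Christoffel term, so the second derivative
  of \<open>f \<circ> c\<close> is the covariant Hessian evaluated at the velocity.\<close>

lemma hessian_nonneg_imp_g_convex:
  assumes D: "second_order_derivatives V f D H"
    and nonneg: "\<And>x v. x \<in> V \<Longrightarrow> D x (christoffel nabla x v v) \<le> H x v v"
  shows "g_convex V nabla f"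
  unfolding g_convex_def
proof (intro allI impI)
  fix c assume "geodesic V nabla c"
  then obtain c' where cV: "\<And>t. t \<in> {0..1} \<Longrightarrow> c t \<in> V"
    and c: "\<And>t. t \<in> {0..1} \<Longrightarrow> (c has_vector_derivative c' t) (at t within {0..1})"
      "\<And>t. t \<in> {0..1} \<Longrightarrow>
        (c' has_vector_derivative - christoffel nabla (c t) (c' t) (c' t)) (at t within {0..1})"
    unfolding geodesic_def by blast
  have im: "c ` {0..1} \<subseteq> V"
    using cV by auto
  note d = second_order_derivatives_along_curve[OF D im _ c]
  show "convex_on {0..1} (f \<circ> c)"
  proof (rule convex_on_Icc_nonneg_second_derivative[OF d])
    fix t :: real assume t: "t \<in> {0..1}"
    have "linear (D (c t))"
      using D cV[OF t] by (auto simp: second_order_derivatives_def intro: has_derivative_linear)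
    then show "0 \<le> H (c t) (c' t) (c' t) + D (c t) (- christoffel nabla (c t) (c' t) (c' t))"
      using nonneg[OF cV[OF t], of "c' t"] by (simp add: linear_neg)
  qed auto
qed

subsection \<open>Existence of geodesics\<close>

text \<open>Picard-Lindelof: the integral operator \<open>\<Phi>\<close> is a contraction on the
  bounded continuous curves with values in the closed unit ball around \<open>y0\<close>, and its
  fixed point solves the equation.\<close>

lemma picard_local_solution:
  fixes F :: "'a::euclidean_space \<Rightarrow> 'a"
  assumes lip: "L-lipschitz_on (cball y0 1) F"
  obtains T y where "0 < T" "y 0 = y0"
    "\<And>t. t \<in> {0..T} \<Longrightarrow> (y has_vector_derivative F (y t)) (at t within {0..T})"
proof -
  have L: "0 \<le> L"
    using lip lipschitz_on_nonneg by blast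
  have contF: "continuous_on (cball y0 1) F"
    using lip lipschitz_on_continuous_on by blast
  \<comment> \<open>A bound for \<open>F\<close> on the ball: since the radius is 1, the Lipschitz
    condition adds at most \<open>L\<close> to the norm at the centre.\<close>
  define M where "M = norm (F y0) + L"
  have bound: "norm (F y) \<le> M" if "y \<in> cball y0 1" for y
  proof -
    have "norm (F y - F y0) \<le> L * dist y y0"
      using lipschitz_onD[OF lip that, of y0] by (simp add: dist_norm)
    also have "\<dots> \<le> L"
      using that L mult_left_le[of "dist y y0" L] by (simp add: dist_commute)
    finally show ?thesis
      unfolding M_def using norm_triangle_sub[of "F y" "F y0"] by simp
  qed
  have M: "0 \<le> M" "L \<le> M"
    using L by (auto simp: M_def)
  \<comment> \<open>Short enough that \<open>\<Phi>\<close> keeps curves in the ball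
    (\<open>M * T \<le> 1\<close>) and contracts by 1/2 (\<open>L * T \<le> 1 / 2\<close>, using
    \<open>L \<le> M\<close>). The summand 1 covers \<open>M = 0\<close>.\<close>
  define T where "T = 1 / (2 * M + 1)"
  have T: "0 < T" "M * T \<le> 1" "L * T \<le> 1 / 2"
    using M L by (auto simp: T_def field_simps)
  \<comment> \<open>Bounded continuous functions live on the whole real line, so time is clamped to
    \<open>{0..T}\<close>, which makes \<open>\<Phi> y\<close> constant outside that
    interval.\<close>
  define cl where "cl t = max 0 (min T t)" for t :: real
  have cl: "cl t \<in> {0..T}" for t
    using T by (auto simp: cl_def)
  have cl_id: "cl t = t" if "t \<in> {0..T}" for t
    using that by (auto simp: cl_def)
  define S where "S = (PiC UNIV (\<lambda>_. cball y0 1) :: (real \<Rightarrow>\<^sub>C 'a) set)"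
  define \<Phi> where "\<Phi> y t = y0 + integral {0..cl t} (\<lambda>s. F (apply_bcontfun y s))" for y t
  have S: "apply_bcontfun y s \<in> cball y0 1" if "y \<in> S" for y s
    using that mem_PiC_iff[of y UNIV "\<lambda>_. cball y0 1"] unfolding S_def by auto
  have contFy: "continuous_on A (\<lambda>s. F (apply_bcontfun y s))" if "y \<in> S" for A y
    using S[OF that] by (auto intro!: continuous_on_compose2[OF contF])
  have int: "(\<lambda>s. F (apply_bcontfun y s)) integrable_on {a..b}" if "y \<in> S" for a b y
    by (intro integrable_continuous_real contFy that)
  have \<Phi>_cball: "\<Phi> y t \<in> cball y0 1" if "y \<in> S" for y t
  proof -
    have "norm (integral {0..cl t} (\<lambda>s. F (apply_bcontfun y s))) \<le> M * (cl t - 0)"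
      by (rule integral_bound) (use cl[of t] contFy[OF that] bound S[OF that] in auto)
    also have "\<dots> \<le> M * T"
      using cl[of t] M by (intro mult_left_mono) auto
    finally show ?thesis
      using T by (simp add: \<Phi>_def dist_norm)
  qed
  have \<Phi>_bcont: "\<Phi> y \<in> bcontfun" if "y \<in> S" for y
  proof -
    have "continuous_on UNIV cl"
      unfolding cl_def[abs_def] by (intro continuous_intros)
    then have "continuous_on UNIV (\<Phi> y)"
      unfolding \<Phi>_def[abs_def] using cl
      by (intro continuous_on_add continuous_on_const
          continuous_on_compose2[OF indefinite_integral_continuous_1[OF int[OF that], of 0 T]]) auto
    moreover have "bounded (range (\<Phi> y))"
      using \<Phi>_cball[OF that] by (intro bounded_subset[OF bounded_cball[of y0 1]]) blast
    ultimately show ?thesis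
      by (simp add: bcontfun_def)
  qed
  have apply_\<Phi>: "apply_bcontfun (Bcontfun (\<Phi> y)) = \<Phi> y" if "y \<in> S" for y
    using Bcontfun_inverse[OF \<Phi>_bcont[OF that]] .
  have "\<exists>!y\<in>S. Bcontfun (\<Phi> y) = y"
  proof (rule Banach_fix[where c = "1/2"])
    show "complete S"
      unfolding S_def complete_eq_closed by (rule closed_PiC) auto
    have "const_bcontfun y0 \<in> S"
      unfolding S_def mem_PiC_iff by (simp add: const_bcontfun.rep_eq)
    then show "S \<noteq> {}"
      by blast
    show "(\<lambda>y. Bcontfun (\<Phi> y)) ` S \<subseteq> S"
      using \<Phi>_cball apply_\<Phi> unfolding S_def by (auto simp: mem_PiC_iff)
    fix y z assume yz: "y \<in> S" "z \<in> S"
    show "dist (Bcontfun (\<Phi> y)) (Bcontfun (\<Phi> z)) \<le> 1 / 2 * dist y z"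
    proof (rule dist_bound)
      fix t
      have "norm (F (apply_bcontfun y s) - F (apply_bcontfun z s)) \<le> L * dist y z" for s
        using lipschitz_onD[OF lip S[OF yz(1)] S[OF yz(2)], of s s] dist_bounded[of y s z] L
        by (metis (no_types) dist_norm mult_left_mono order_trans)
      then have "norm (integral {0..cl t} (\<lambda>s. F (apply_bcontfun y s) - F (apply_bcontfun z s)))
          \<le> L * dist y z * (cl t - 0)"
        using cl[of t] by (intro integral_bound continuous_on_diff contFy yz) auto
      also have "\<dots> \<le> L * dist y z * T"
        using cl[of t] L by (intro mult_left_mono) auto
      also have "\<dots> = L * T * dist y z"
        by (simp only: mult_ac)
      also have "\<dots> \<le> 1 / 2 * dist y z"
        by (intro mult_right_mono T) simp
      finally show "dist (apply_bcontfun (Bcontfun (\<Phi> y)) t) (apply_bcontfun (Bcontfun (\<Phi> z)) t)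
          \<le> 1 / 2 * dist y z"
        by (simp add: apply_\<Phi> yz \<Phi>_def dist_norm integral_diff[OF int int] yz)
    qed
  qed auto
  then obtain y where y: "y \<in> S" "Bcontfun (\<Phi> y) = y"
    by blast
  have fix_eq: "apply_bcontfun y t = \<Phi> y t" for t
    using apply_\<Phi>[OF y(1)] y(2) by simp
  show ?thesis
  proof
    show "0 < T"
      by (rule T)
    show "apply_bcontfun y 0 = y0"
      unfolding fix_eq[of 0] using T by (simp add: \<Phi>_def cl_def)
    fix t assume t: "t \<in> {0..T}"
    \<comment> \<open>On \<open>{0..T}\<close> the clamp is the identity, so the fixed point is this
      indefinite integral, and the fundamental theorem of calculus differentiates it.\<close>
    have "((\<lambda>s. y0 + integral {0..s} (\<lambda>s. F (apply_bcontfun y s))) has_vector_derivative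
        0 + F (apply_bcontfun y t)) (at t within {0..T})"
      by (intro has_vector_derivative_add has_vector_derivative_const
          integral_has_vector_derivative[OF contFy[OF y(1)] t])
    then have "((\<lambda>s. y0 + integral {0..s} (\<lambda>s. F (apply_bcontfun y s))) has_vector_derivative
        F (apply_bcontfun y t)) (at t within {0..T})"
      by simp
    then show "(apply_bcontfun y has_vector_derivative F (apply_bcontfun y t)) (at t within {0..T})"
      by (rule has_vector_derivative_transform[OF t, rotated]) (subst fix_eq, simp add: \<Phi>_def cl_id)
  qed
qed

lemma onorm_le_sum_Basis:
  fixes f' :: "'a::euclidean_space \<Rightarrow> 'b::real_normed_vector"
  assumes "linear f'"
  shows "onorm f' \<le> (\<Sum>b\<in>Basis. norm (f' b))"
proof (rule onorm_le)
  fix x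
  have "f' x = (\<Sum>b\<in>Basis. (x \<bullet> b) *\<^sub>R f' b)"
    by (rule linear_basis_expand[OF assms])
  also have "norm \<dots> \<le> (\<Sum>b\<in>Basis. \<bar>x \<bullet> b\<bar> * norm (f' b))"
    using norm_sum[of "\<lambda>b. (x \<bullet> b) *\<^sub>R f' b" Basis] by simp
  also have "\<dots> \<le> (\<Sum>b\<in>Basis. norm x * norm (f' b))"
    by (intro sum_mono mult_right_mono Basis_le_norm) auto
  finally show "norm (f' x) \<le> (\<Sum>b\<in>Basis. norm (f' b)) * norm x"
    by (simp add: sum_distrib_left mult.commute)
qed

text \<open>The partial derivatives are continuous, hence bounded on the compact ball. They bound
  the operator norm of the derivative, and the ball is convex, so the mean value inequality
  applies.\<close>

lemma Ck_on_1_lipschitz_on_cball: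
  fixes F :: "'a::euclidean_space \<Rightarrow> 'b::euclidean_space"
  assumes "Ck_on 1 UNIV F"
  obtains L where "L-lipschitz_on (cball y0 r) F"
proof -
  obtain F' where F': "\<And>x. (F has_derivative F' x) (at x)"
    and cont: "\<And>v. continuous_on UNIV (\<lambda>x. F' x v)"
    using assms by auto
  have "continuous_on (cball y0 r) (\<lambda>x. \<Sum>b\<in>Basis. norm (F' x b))"
    by (intro continuous_intros continuous_on_subset[OF cont]) auto
  then have "bounded ((\<lambda>x. \<Sum>b\<in>Basis. norm (F' x b)) ` cball y0 r)"
    using compact_continuous_image compact_cball compact_imp_bounded by blast
  then obtain L where L: "0 < L" "\<And>x. x \<in> cball y0 r \<Longrightarrow> (\<Sum>b\<in>Basis. norm (F' x b)) \<le> L"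
    unfolding bounded_pos by (metis abs_le_D1 image_eqI real_norm_def)
  have "onorm (F' x) \<le> L" if "x \<in> cball y0 r" for x
    using onorm_le_sum_Basis[OF has_derivative_linear[OF F'[of x]]] L(2)[OF that]
    by linarith
  then have "norm (F x - F y) \<le> L * norm (x - y)" if "x \<in> cball y0 r" "y \<in> cball y0 r" for x y
    by (rule differentiable_bound[OF convex_cball has_derivative_at_withinI[OF F'] _ that])
  then show ?thesis
    using L(1) by (intro that[of L] lipschitz_onI) (auto simp: dist_norm)
qed

lemma smooth_on_Pair:
  assumes "smooth_on V f" "smooth_on V g"
  shows "smooth_on V (\<lambda>x. (f x, g x))"
proof -
  have "smooth_on V (\<lambda>x. (f x, 0) + (0, g x))"
    by (intro smooth_on_add smooth_on_linear_comp[OF _ assms(1), where L = "\<lambda>y. (y, 0)"]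
        smooth_on_linear_comp[OF _ assms(2), where L = "\<lambda>y. (0, y)"]
        bounded_linear_Pair bounded_linear_ident bounded_linear_zero)
  then show ?thesis
    by simp
qed

text \<open>The local solution lives on a short interval of length \<open>T\<close>. Slowing time
  down by the factor \<open>T\<close> gives a curve on \<open>{0..1}\<close> with initial velocity
  \<open>T *\<^sub>R v\<close>, and it is again a geodesic because the equation is quadratic in the
  velocity.\<close>

lemma geodesic_exists:
  fixes G :: "'a::euclidean_space \<Rightarrow> 'a \<Rightarrow> 'a \<Rightarrow> 'a"
  assumes G: "christoffel_symbols UNIV G"
  obtains T c c' where "0 < T" "c 0 = x" "c' 0 = T *\<^sub>R v"
    "\<And>t. t \<in> {0..1::real} \<Longrightarrow> (c has_vector_derivative c' t) (at t within {0..1})"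
    "\<And>t. t \<in> {0..1} \<Longrightarrow> (c' has_vector_derivative - G (c t) (c' t) (c' t)) (at t within {0..1})"
proof -
  have bil: "\<And>x. bilinear (G x)" and sm: "\<And>u v. smooth_on UNIV (\<lambda>x. G x u v)"
    using G by (auto simp: christoffel_symbols_def)
  \<comment> \<open>The geodesic spray: the second-order equation becomes an autonomous first-order
    one for pairs of position and velocity.\<close>
  define F where "F p = (snd p, - G (fst p) (snd p) (snd p))" for p :: "'a \<times> 'a"
  have "smooth_on UNIV (\<lambda>p. G (0 + fst p) b c)" for b c
    by (rule smooth_on_affine_comp[OF sm bounded_linear_fst]) auto
  then have "smooth_on UNIV (\<lambda>p. \<Sum>b\<in>Basis. \<Sum>c\<in>Basis.
      ((snd p \<bullet> b) * (snd p \<bullet> c)) *\<^sub>R G (fst p) b c)"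
    by (intro smooth_on_sum smooth_on_scaleR smooth_on_mult smooth_on_inner_left
        smooth_on_linear_comp[OF bounded_linear_snd] smooth_on_ident) simp
  then have "smooth_on UNIV (\<lambda>p. G (fst p) (snd p) (snd p))"
    by (subst bilinear_basis_expand[OF bil])
  then have "smooth_on UNIV F"
    unfolding F_def[abs_def]
    by (intro smooth_on_Pair smooth_on_linear_comp[OF bounded_linear_snd] smooth_on_ident
        smooth_on_linear_comp[OF bounded_linear_minus[OF bounded_linear_ident]])
  then have "Ck_on 1 UNIV F"
    by (simp add: smooth_on_def del: One_nat_def)
  then obtain L where "L-lipschitz_on (cball (x, v) 1) F"
    using Ck_on_1_lipschitz_on_cball by blast
  then obtain T y where T: "0 < T" "y 0 = (x, v)"
    and y: "\<And>t. t \<in> {0..T} \<Longrightarrow> (y has_vector_derivative F (y t)) (at t within {0..T})"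
    using picard_local_solution by blast
  have y1: "((\<lambda>t. y (T * t)) has_vector_derivative T *\<^sub>R F (y (T * t))) (at t within {0..1})"
    if "t \<in> {0..1}" for t
  proof -
    have im: "(\<lambda>t. T * t) ` {0..1} \<subseteq> {0..T}"
      using T(1) by (auto simp: mult_left_le)
    have "((\<lambda>t. T * t) has_vector_derivative T) (at t within {0..1})"
      by (auto intro!: derivative_eq_intros)
    moreover have "(y has_vector_derivative F (y (T * t))) (at (T * t) within (\<lambda>t. T * t) ` {0..1})"
      using im that by (intro has_vector_derivative_within_subset[OF y im]) blast
    ultimately show ?thesis
      using vector_diff_chain_within[of "\<lambda>t. T * t" T t "{0..1}" y "F (y (T * t))"]
      by (simp add: o_def)
  qed
  show ?thesis
  proof (rule that[of T "\<lambda>t. fst (y (T * t))" "\<lambda>t. T *\<^sub>R snd (y (T * t))"])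
    fix t :: real assume t: "t \<in> {0..1}"
    show "((\<lambda>t. fst (y (T * t))) has_vector_derivative T *\<^sub>R snd (y (T * t))) (at t within {0..1})"
      using bounded_linear.has_vector_derivative[OF bounded_linear_fst y1[OF t]]
      by (simp add: F_def)
    show "((\<lambda>t. T *\<^sub>R snd (y (T * t))) has_vector_derivative
        - G (fst (y (T * t))) (T *\<^sub>R snd (y (T * t))) (T *\<^sub>R snd (y (T * t)))) (at t within {0..1})"
      using bounded_linear.has_vector_derivative[OF
          bounded_linear_compose[OF bounded_linear_scaleR_right bounded_linear_snd] y1[OF t], of T]
      by (simp add: F_def bilinear_lmul[OF bil] bilinear_rmul[OF bil])
  qed (use T in auto)
qed

subsection \<open>The Hessian inequality is necessary\<close>

text \<open>If \<open>d\<close> were negative, \<open>h'\<close> would be smaller just to the right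
  of \<open>t\<close>. The tangent inequalities at \<open>t\<close> and \<open>t + r\<close>, added
  together, say the opposite.\<close>

lemma convex_on_Icc_second_derivative_nonneg:
  fixes h h' :: "real \<Rightarrow> real"
  assumes convex: "convex_on {a..b} h" and t: "a < t" "t < b"
    and h: "\<And>s. s \<in> {a..b} \<Longrightarrow> (h has_vector_derivative h' s) (at s within {a..b})"
    and h'': "(h' has_vector_derivative d) (at t within {a..b})"
  shows "0 \<le> d"
proof (rule ccontr)
  assume "\<not> 0 \<le> d"
  then have "d < 0"
    by simp
  have "(h' has_real_derivative d) (at t)"
    using h'' t by (simp add: has_real_derivative_iff_has_vector_derivative at_within_Icc_at)
  from DERIV_neg_dec_right[OF this \<open>d < 0\<close>]
  obtain \<delta> where \<delta>: "0 < \<delta>" "\<And>r. 0 < r \<Longrightarrow> r < \<delta> \<Longrightarrow> h' (t + r) < h' t"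
    by blast
  define r where "r = min (\<delta> / 2) ((b - t) / 2)"
  have r: "0 < r" "r < \<delta>" "t + r < b"
    using \<delta>(1) t by (auto simp: r_def min_def field_simps)
  have tangent: "h' z * (y - z) \<le> h y - h z" if "z \<in> {a<..<b}" "y \<in> {a..b}" for y z
    using convex_on_imp_above_tangent[OF convex _ _ that(2), of z "h' z"] h[of z] that
    by (simp add: has_real_derivative_iff_has_vector_derivative)
  have "h' t * r \<le> h (t + r) - h t" "h' (t + r) * (- r) \<le> h t - h (t + r)"
    using tangent[of t "t + r"] tangent[of "t + r" t] t r by auto
  then have "h' t * r \<le> h' (t + r) * r"
    by simp
  then show False
    using \<delta>(2)[OF r(1,2)] r(1) by simp
qed

text \<open>Test convexity on a geodesic starting at \<open>x\<close> with velocity a positive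
  multiple of \<open>v\<close>; the multiple only contributes the factor
  \<open>T\<^sup>2\<close>.\<close>

lemma g_convex_imp_hessian_nonneg:
  fixes f :: "'a::euclidean_space \<Rightarrow> real"
  assumes nabla: "connection UNIV nabla" and conv: "g_convex UNIV nabla f"
    and D: "second_order_derivatives UNIV f D H"
    and smooth: "\<And>v. smooth_on UNIV (\<lambda>x. D x v)" "\<And>u v. smooth_on UNIV (\<lambda>x. H x u v)"
  shows "D x (christoffel nabla x v v) \<le> H x v v"
proof -
  define G where "G = christoffel nabla"
  have G: "christoffel_symbols UNIV G"
    using christoffel_symbols_pullback[OF subspace_UNIV nabla bounded_linear_ident]
    by (simp add: G_def)
  then have bil: "\<And>x. bilinear (G x)" and sm: "\<And>u v. smooth_on UNIV (\<lambda>x. G x u v)"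
    by (auto simp: christoffel_symbols_def)
  have bilH: "bilinear (H x)" and linD: "linear (D x)" for x
    using D by (auto simp: second_order_derivatives_def intro: has_derivative_linear)
  \<comment> \<open>The covariant Hessian of \<open>f\<close>, a bilinear form depending
    continuously on the point.\<close>
  define Q where "Q x u v = H x u v - D x (G x u v)" for x u v
  have bilQ: "bilinear (Q x)" for x
    using bilH[of x] bil[of x] linear_compose[OF _ linD[of x]] unfolding bilinear_def Q_def
    by (auto intro!: linear_compose_sub simp: o_def)
  have smQ: "continuous_on UNIV (\<lambda>x. Q x u v)" for u v
  proof -
    have "Q x u v = H x u v - (\<Sum>b\<in>Basis. (G x u v \<bullet> b) *\<^sub>R D x b)" for x
      unfolding Q_def by (subst linear_basis_expand[OF linD]) (rule refl)
    then show ?thesis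
      using smooth[THEN smooth_on_imp_continuous_on] sm[THEN smooth_on_imp_continuous_on]
      by (auto intro!: continuous_intros)
  qed
  obtain T c c' where T: "0 < T" and c0: "c 0 = x" "c' 0 = T *\<^sub>R v"
    and c: "\<And>t. t \<in> {0..1::real} \<Longrightarrow> (c has_vector_derivative c' t) (at t within {0..1})"
      "\<And>t. t \<in> {0..1} \<Longrightarrow> (c' has_vector_derivative - G (c t) (c' t) (c' t)) (at t within {0..1})"
    using geodesic_exists[OF G] by metis
  have "geodesic UNIV nabla c"
    unfolding geodesic_def using c G_def by blast
  then have convex: "convex_on {0..1} (f \<circ> c)"
    using conv by (simp add: g_convex_def)
  note d = second_order_derivatives_along_curve[OF D subset_UNIV _ c]
  have Q_nonneg: "0 \<le> Q (c t) (c' t) (c' t)" if "0 < t" "t < 1" for t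
  proof -
    have t: "t \<in> {0..1}"
      using that by simp
    show ?thesis
      using convex_on_Icc_second_derivative_nonneg[OF convex that d(1) d(2)[OF t t t]]
      by (simp add: Q_def linear_neg[OF linD])
  qed
  \<comment> \<open>The second derivative test works at interior times only, whereas
    \<open>x\<close> is the starting point, so the inequality is carried to time 0 as a right-hand
    limit.\<close>
  have "continuous_on {0..1} c" "continuous_on {0..1} c'"
    by (rule continuous_on_vector_derivative[OF c(1)], assumption)
      (rule continuous_on_vector_derivative[OF c(2)])
  then have "continuous_on {0..1} (\<lambda>t. \<Sum>b\<in>Basis. \<Sum>e\<in>Basis.
      ((c' t \<bullet> b) * (c' t \<bullet> e)) *\<^sub>R Q (c t) b e)"
    by (intro continuous_intros continuous_on_compose2[OF smQ]) auto
  then have "continuous_on {0..1} (\<lambda>t. Q (c t) (c' t) (c' t))"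
    by (subst bilinear_basis_expand[OF bilQ])
  then have "((\<lambda>t. Q (c t) (c' t) (c' t)) \<longlongrightarrow> Q x (T *\<^sub>R v) (T *\<^sub>R v)) (at 0 within {0..1})"
    using c0 by (force simp: continuous_on)
  then have "((\<lambda>t. Q (c t) (c' t) (c' t)) \<longlongrightarrow> Q x (T *\<^sub>R v) (T *\<^sub>R v)) (at_right 0)"
    by (simp add: at_within_Icc_at_right)
  moreover have "\<forall>\<^sub>F t in at_right 0. 0 \<le> Q (c t) (c' t) (c' t)"
    using Q_nonneg by (auto simp: eventually_at_right[of 0 1] intro!: exI[of _ 1])
  ultimately have "0 \<le> Q x (T *\<^sub>R v) (T *\<^sub>R v)"
    by (rule tendsto_lowerbound) simp
  also have "\<dots> = T\<^sup>2 * Q x v v"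
    by (simp add: bilinear_lmul[OF bilQ] bilinear_rmul[OF bilQ] power2_eq_square)
  finally show ?thesis
    using T by (simp add: zero_le_mult_iff Q_def G_def)
qed

subsection \<open>Functions without critical points\<close>

text \<open>Each \<open>D y v\<close> is smooth in \<open>y\<close> and can be differentiated again,
  separately for each \<open>v\<close>. Linearity of the result in \<open>v\<close> then follows
  from uniqueness of derivatives.\<close>

lemma smooth_on_second_order_derivatives:
  fixes f :: "'a::euclidean_space \<Rightarrow> real"
  assumes "smooth_on UNIV f"
  obtains D H where "second_order_derivatives UNIV f D H"
    and "\<And>v. smooth_on UNIV (\<lambda>x. D x v)" "\<And>u v. smooth_on UNIV (\<lambda>x. H x u v)"
proof -
  obtain D where D: "\<And>x. (f has_derivative D x) (at x)" "\<And>v. smooth_on UNIV (\<lambda>x. D x v)"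
    using smooth_on_derivative[OF subspace_UNIV assms] by auto
  have "\<exists>h. \<forall>x. ((\<lambda>y. D y v) has_derivative h x) (at x) \<and> (\<forall>w. smooth_on UNIV (\<lambda>x. h x w))" for v
    using smooth_on_derivative[OF subspace_UNIV D(2)[of v]] by (metis UNIV_I)
  then obtain h where h: "\<And>v x. ((\<lambda>y. D y v) has_derivative h v x) (at x)"
    "\<And>v w. smooth_on UNIV (\<lambda>x. h v x w)"
    by metis
  note linD = has_derivative_linear[OF D(1)]
  have "linear (\<lambda>v. h v x w)" for x w
  proof (rule linearI)
    fix u v r
    have "((\<lambda>y. D y (u + v)) has_derivative (\<lambda>w. h u x w + h v x w)) (at x)"
      using has_derivative_add[OF h(1)[of u x] h(1)[of v x]] by (simp add: linear_add[OF linD])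
    then show "h (u + v) x w = h u x w + h v x w"
      using has_derivative_unique[OF h(1)] by metis
    have "((\<lambda>y. D y (r *\<^sub>R u)) has_derivative (\<lambda>w. r *\<^sub>R h u x w)) (at x)"
      using has_derivative_scaleR_right[OF h(1)[of u x], of r] by (simp add: linear_scale[OF linD])
    then show "h (r *\<^sub>R u) x w = r *\<^sub>R h u x w"
      using has_derivative_unique[OF h(1)] by metis
  qed
  then have "second_order_derivatives UNIV f D (\<lambda>x v. h v x)"
    using D(1) h(1) has_derivative_linear[OF h(1)]
    by (simp add: second_order_derivatives_def bilinear_def)
  then show ?thesis
    using D(2) h(2) that by blast
qed

text \<open>The Hessian is symmetrised because its symmetry is not at hand; only its diagonal matters.\<close>

lemma no_critical_point_imp_g_convex_connection:
  fixes f :: "'a::euclidean_space \<Rightarrow> real"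
  assumes smooth: "smooth_on UNIV f" and nocrit: "\<nexists>x. critical_point f x"
  shows "g_convex_connection UNIV f"
proof -
  obtain D H where DH: "second_order_derivatives UNIV f D H"
    and smD: "\<And>v. smooth_on UNIV (\<lambda>x. D x v)" and smH: "\<And>u v. smooth_on UNIV (\<lambda>x. H x u v)"
    using smooth_on_second_order_derivatives[OF smooth] by blast
  have fD: "\<And>x. (f has_derivative D x) (at x)" and bil: "\<And>x. bilinear (H x)"
    using DH by (auto simp: second_order_derivatives_def)
  note linD = has_derivative_linear[OF fD]
  define N where "N x = (\<Sum>b\<in>Basis. D x b * D x b)" for x
  define grad where "grad x = (\<Sum>b\<in>Basis. D x b *\<^sub>R b)" for x
  define G where "G x u v = ((H x u v + H x v u) * (1 / 2) * inverse (N x)) *\<^sub>R grad x" for x u v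
  have N: "N x \<noteq> 0" for x
  proof
    assume "N x = 0"
    then have "D x b = 0" if "b \<in> Basis" for b
      using that by (simp add: N_def sum_nonneg_eq_0_iff)
    then have "D x = (\<lambda>_. 0)"
      by (intro ext, subst linear_basis_expand[OF linD]) simp
    then show False
      using nocrit fD[of x] by (simp add: critical_point_def)
  qed
  \<comment> \<open>This cancels the factor \<open>inverse (N x)\<close> in \<open>G\<close>, so the
    covariant Hessian vanishes identically.\<close>
  have "D x (grad x) = N x" for x
    by (simp add: grad_def N_def linear_sum[OF linD] linear_scale[OF linD])
  then have "D x (G x v v) = H x v v" for x v
    using N[of x] by (simp add: G_def linear_scale[OF linD])
  then have convex: "g_convex UNIV (christoffel_connection G) f"
    by (intro hessian_nonneg_imp_g_convex[OF DH]) simp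
  have "linear (\<lambda>u. G x u v)" for x v
    unfolding G_def
    by (rule linearI) (simp_all add: bilinear_ladd[OF bil] bilinear_radd[OF bil] bilinear_lmul[OF bil]
        bilinear_rmul[OF bil] algebra_simps add_divide_distrib)
  moreover have sym: "G x u v = G x v u" for x u v
    by (simp add: G_def add.commute)
  ultimately have "bilinear (G x)" for x
    unfolding bilinear_def by (metis (no_types, lifting) ext)
  moreover have "smooth_on UNIV (\<lambda>x. G x u v)" for u v
    unfolding G_def grad_def N_def
    by (intro smooth_on_scaleR smooth_on_mult smooth_on_add smooth_on_sum smH smD smooth_on_const
        smooth_on_inverse) (use N in \<open>auto simp: N_def\<close>)
  ultimately have "christoffel_symbols UNIV G"
    using sym by (simp add: christoffel_symbols_def)
  then show ?thesis
    using convex connection_christoffel_connection[OF subspace_UNIV]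
    unfolding g_convex_connection_def by blast
qed

subsection \<open>Product connections\<close>

text \<open>Compatibility for constant fields suffices: for moving fields the product rule adds the
  terms with \<open>along X Y\<close> and \<open>along X Z\<close>, which are the flat parts of the
  connection.\<close>

lemma levi_civita_christoffel_connection:
  fixes g :: "'a::euclidean_space \<Rightarrow> 'a \<Rightarrow> 'a \<Rightarrow> real"
  assumes g: "pseudo_riemannian_metric UNIV g" and G: "christoffel_symbols UNIV G"
    and compat: "\<And>x v w. ((\<lambda>y. g y v w) has_derivative
      (\<lambda>u. g x (G x u v) w + g x v (G x u w))) (at x)"
  shows "levi_civita UNIV g (christoffel_connection G)"
  unfolding levi_civita_def
proof (intro conjI ballI)
  show "connection UNIV (christoffel_connection G)"
    by (rule connection_christoffel_connection[OF subspace_UNIV G])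
  fix X Y Z :: "'a \<Rightarrow> 'a" and x
  assume XYZ: "X \<in> vector_fields UNIV" "Y \<in> vector_fields UNIV" "Z \<in> vector_fields UNIV"
  have sym: "g x u v = g x v u" for x u v
    using g by (simp add: pseudo_riemannian_metric_def)
  have "g x (u + v) w = g x u w + g x v w" "g x (r *\<^sub>R u) v = r * g x u v" for x u v w r
    using g unfolding pseudo_riemannian_metric_def by blast+
  then have "linear (\<lambda>u. g x u v)" for x v
    by (intro linearI) simp_all
  moreover from this have "linear (g x u)" for x u
    using sym[of x u] by (metis (no_types, lifting) ext)
  ultimately have bil: "bilinear (g x)" for x
    by (simp add: bilinear_def)
  have bilG: "bilinear (G x)" for x
    using G by (simp add: christoffel_symbols_def)
  obtain Y' Z' where Y': "(Y has_derivative Y') (at x)" and Z': "(Z has_derivative Z') (at x)"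
    using XYZ smooth_on_derivative[OF subspace_UNIV] unfolding vector_fields_def
    by (metis (no_types, lifting) UNIV_I mem_Collect_eq)
  define h where "h = X x"
  \<comment> \<open>The derivative of the metric in direction \<open>h\<close> on constant
    arguments. Being bilinear, it equals the coefficient sum produced by
    \<open>has_derivative_bilinear_apply\<close>.\<close>
  define B where "B v w = g x (G x h v) w + g x v (G x h w)" for v w
  have "bilinear B"
    unfolding bilinear_def B_def
    by (auto intro!: linearI simp: bilinear_ladd[OF bil] bilinear_radd[OF bil] bilinear_lmul[OF bil]
        bilinear_rmul[OF bil] bilinear_radd[OF bilG] bilinear_rmul[OF bilG] algebra_simps)
  from bilinear_basis_expand[OF this, of "Y x" "Z x"]
  have "along X (\<lambda>y. g y (Y y) (Z y)) x = B (Y x) (Z x) + (g x (Y' h) (Z x) + g x (Y x) (Z' h))"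
    using along_eq[of UNIV x X, OF subspace_UNIV _ _
        has_derivative_bilinear_apply[of UNIV g x, OF bil _ compat Y' Z']]
    by (simp add: B_def h_def)
  moreover have "along X Y x = Y' h" "along X Z x = Z' h"
    using along_eq[of UNIV x X, OF subspace_UNIV _ _ Y'] along_eq[of UNIV x X, OF subspace_UNIV _ _ Z']
    by (simp_all add: h_def)
  ultimately show "along X (\<lambda>y. g y (Y y) (Z y)) x =
      g x (christoffel_connection G X Y x) (Z x) + g x (Y x) (christoffel_connection G X Z x)"
    by (simp add: christoffel_connection_def B_def h_def bilinear_ladd[OF bil] bilinear_radd[OF bil])
qed

section \<open>Direct sums of subspaces\<close>

text \<open>A coordinate-free setting for the product arguments. Conditions on a single summand hold
  for every index, as they do for any coordinate subspace; those relating the summands to each other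
  concern \<open>I\<close> only, where the blocks form a partition.\<close>

locale direct_sum_decomposition =
  fixes I :: "'i set" and V :: "'i \<Rightarrow> 'a::euclidean_space set" and p :: "'i \<Rightarrow> 'a \<Rightarrow> 'a"
  assumes finite_I: "finite I"
    and subspace_V: "\<And>t. subspace (V t)"
    and p_linear: "\<And>t. bounded_linear (p t)"
    and p_in_V: "\<And>t x. p t x \<in> V t"
    and p_id: "\<And>t x. x \<in> V t \<Longrightarrow> p t x = x"
    and p_other: "\<And>t t' x. t \<in> I \<Longrightarrow> t' \<in> I \<Longrightarrow> t \<noteq> t' \<Longrightarrow> x \<in> V t' \<Longrightarrow> p t x = 0"
    and sum_p: "\<And>x. (\<Sum>t\<in>I. p t x) = x"
begin

lemmas p_simps = linear_add[OF bounded_linear.linear[OF p_linear]]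
  linear_diff[OF bounded_linear.linear[OF p_linear]]
  linear_scale[OF bounded_linear.linear[OF p_linear]]

lemma p_sum:
  assumes "t \<in> I" "\<And>t'. t' \<in> I \<Longrightarrow> w t' \<in> V t'"
  shows "p t (\<Sum>t'\<in>I. w t') = w t"
proof -
  have "p t (\<Sum>t'\<in>I. w t') = (\<Sum>t'\<in>I. p t (w t'))"
    by (rule linear_sum[OF bounded_linear.linear[OF p_linear]])
  also have "\<dots> = (\<Sum>t'\<in>I. if t' = t then w t else 0)"
    using assms p_id p_other by (intro sum.cong) auto
  finally show ?thesis
    using finite_I assms(1) by simp
qed

lemma smooth_on_comp_p: "smooth_on (V t) h \<Longrightarrow> smooth_on UNIV (\<lambda>x. h (p t x))"
  using smooth_on_affine_comp[of "V t" h "p t" UNIV 0] p_linear p_in_V by auto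

text \<open>The symbols of the product connection. They are block diagonal: vectors from different
  summands do not interact.\<close>

definition sum_christoffel ::
  "('i \<Rightarrow> ('a \<Rightarrow> 'a) \<Rightarrow> ('a \<Rightarrow> 'a) \<Rightarrow> 'a \<Rightarrow> 'a) \<Rightarrow> 'a \<Rightarrow> 'a \<Rightarrow> 'a \<Rightarrow> 'a" where
  "sum_christoffel nabla x u v = (\<Sum>t\<in>I. christoffel (nabla t) (p t x) (p t u) (p t v))"

context
  fixes nabla
  assumes nabla: "\<And>t. t \<in> I \<Longrightarrow> connection (V t) (nabla t)"
begin

lemma component_christoffel_symbols:
  "t \<in> I \<Longrightarrow> christoffel_symbols (V t) (\<lambda>x u v. christoffel (nabla t) x (p t u) (p t v))"
  by (rule christoffel_symbols_pullback[OF subspace_V nabla p_linear]) (use p_in_V in auto)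

lemma christoffel_symbols_sum: "christoffel_symbols UNIV (sum_christoffel nabla)"
proof -
  have C: "\<And>x. x \<in> V t \<Longrightarrow> bilinear (\<lambda>u v. christoffel (nabla t) x (p t u) (p t v))"
    "\<And>u v. smooth_on (V t) (\<lambda>x. christoffel (nabla t) x (p t u) (p t v))"
    "\<And>x u v. x \<in> V t \<Longrightarrow>
      christoffel (nabla t) x (p t u) (p t v) = christoffel (nabla t) x (p t v) (p t u)"
    if "t \<in> I" for t
    using component_christoffel_symbols[OF that] by (auto simp: christoffel_symbols_def)
  have "bilinear (sum_christoffel nabla x)" for x
    using C(1)[OF _ p_in_V] unfolding bilinear_def sum_christoffel_def
    by (auto intro!: linear_compose_sum)
  moreover have "smooth_on UNIV (\<lambda>x. sum_christoffel nabla x u v)" for u v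
    unfolding sum_christoffel_def by (intro smooth_on_sum smooth_on_comp_p C(2))
  moreover have "sum_christoffel nabla x u v = sum_christoffel nabla x v u" for x u v
    unfolding sum_christoffel_def by (intro sum.cong refl C(3) p_in_V)
  ultimately show ?thesis
    by (simp add: christoffel_symbols_def)
qed

lemma p_sum_christoffel:
  assumes "t \<in> I"
  shows "p t (sum_christoffel nabla x u v) = christoffel (nabla t) (p t x) (p t u) (p t v)"
  unfolding sum_christoffel_def
proof (rule p_sum[OF assms])
  fix t' assume "t' \<in> I"
  then show "christoffel (nabla t') (p t' x) (p t' u) (p t' v) \<in> V t'"
    using connection_christoffel(1)[OF subspace_V nabla p_in_V p_in_V] p_in_V
    by (auto simp: vector_fields_def)
qed

text \<open>The projection \<open>p t\<close> is linear, so it commutes with differentiation in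
  time, and by \<open>p_sum_christoffel\<close> it turns the product geodesic equation into that of
  the factor.\<close>

lemma geodesic_component:
  assumes t: "t \<in> I" and c: "geodesic UNIV (christoffel_connection (sum_christoffel nabla)) c"
  shows "geodesic (V t) (nabla t) (\<lambda>r. p t (c r))"
proof -
  obtain c' where c': "\<And>r. r \<in> {0..1} \<Longrightarrow> (c has_vector_derivative c' r) (at r within {0..1})"
    "\<And>r. r \<in> {0..1} \<Longrightarrow>
      (c' has_vector_derivative - sum_christoffel nabla (c r) (c' r) (c' r)) (at r within {0..1})"
    using c unfolding geodesic_def christoffel_christoffel_connection by blast
  have "p t (- sum_christoffel nabla x v v) = - christoffel (nabla t) (p t x) (p t v) (p t v)" for x v
    by (simp add: linear_neg[OF bounded_linear.linear[OF p_linear]] p_sum_christoffel[OF t])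
  then show ?thesis
    using c'[THEN bounded_linear.has_vector_derivative[OF p_linear[of t]]] p_in_V
    unfolding geodesic_def by (auto intro!: exI[of _ "\<lambda>r. p t (c' r)"])
qed

lemma g_convex_sum:
  assumes f: "\<And>x. f x = (\<Sum>t\<in>I. fs t (p t x))"
    and convex: "\<And>t. t \<in> I \<Longrightarrow> g_convex (V t) (nabla t) (fs t)"
  shows "g_convex UNIV (christoffel_connection (sum_christoffel nabla)) f"
  unfolding g_convex_def
proof (intro allI impI)
  fix c assume c: "geodesic UNIV (christoffel_connection (sum_christoffel nabla)) c"
  have conv: "convex_on {0..1} (\<lambda>r. fs t (p t (c r)))" if "t \<in> I" for t
    using convex[OF that] geodesic_component[OF that c] by (auto simp: g_convex_def o_def)
  \<comment> \<open>Generalised to subsets \<open>J\<close> so that finite induction can add one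
    convex summand at a time while \<open>nabla\<close> stays indexed by \<open>I\<close>.\<close>
  have "convex_on {0..1} (\<lambda>r. \<Sum>t\<in>J. fs t (p t (c r)))" if "J \<subseteq> I" for J
    using finite_subset[OF that finite_I] that
    by (induction J rule: finite_induct) (auto intro!: convex_on_add conv simp: convex_on_const)
  from this[OF subset_refl] show "convex_on {0..1} (f \<circ> c)"
    by (simp add: f o_def)
qed

text \<open>The product metric is block diagonal like the symbols, so nondegeneracy and
  compatibility both reduce to single summands.\<close>

lemma levi_civita_sum:
  assumes g: "\<And>t. t \<in> I \<Longrightarrow> pseudo_riemannian_metric (V t) (g t)"
    and lc: "\<And>t. t \<in> I \<Longrightarrow> levi_civita (V t) (g t) (nabla t)"
  defines "gs \<equiv> \<lambda>x u v. \<Sum>t\<in>I. g t (p t x) (p t u) (p t v)"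
  shows "pseudo_riemannian_metric UNIV gs"
    and "levi_civita UNIV gs (christoffel_connection (sum_christoffel nabla))"
proof -
  have gt: "\<And>u v. u \<in> V t \<Longrightarrow> v \<in> V t \<Longrightarrow> smooth_on (V t) (\<lambda>x. g t x u v)"
    "\<And>x u v. x \<in> V t \<Longrightarrow> u \<in> V t \<Longrightarrow> v \<in> V t \<Longrightarrow> g t x u v = g t x v u"
    "\<And>x u v w. x \<in> V t \<Longrightarrow> u \<in> V t \<Longrightarrow> v \<in> V t \<Longrightarrow> w \<in> V t \<Longrightarrow>
      g t x (u + v) w = g t x u w + g t x v w"
    "\<And>x u v r. x \<in> V t \<Longrightarrow> u \<in> V t \<Longrightarrow> v \<in> V t \<Longrightarrow> g t x (r *\<^sub>R u) v = r * g t x u v"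
    "\<And>x u. x \<in> V t \<Longrightarrow> u \<in> V t \<Longrightarrow> (\<And>v. v \<in> V t \<Longrightarrow> g t x u v = 0) \<Longrightarrow> u = 0"
    if "t \<in> I" for t
    using g[OF that] unfolding pseudo_riemannian_metric_def by blast+
  have g0: "g t x u 0 = 0" if "t \<in> I" "x \<in> V t" "u \<in> V t" for t x u
    using gt(2)[OF that subspace_0[OF subspace_V]]
      gt(4)[OF that(1,2) subspace_0[OF subspace_V] that(3), of 0] by simp
  show metric: "pseudo_riemannian_metric UNIV gs"
    unfolding pseudo_riemannian_metric_def
  proof (intro conjI ballI allI impI)
    show "smooth_on UNIV (\<lambda>x. gs x u v)" for u v
      unfolding gs_def by (intro smooth_on_sum smooth_on_comp_p gt(1) p_in_V)
    show "gs x u v = gs x v u" for x u v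
      unfolding gs_def by (intro sum.cong refl gt(2) p_in_V)
    show "gs x (u + v) w = gs x u w + gs x v w" for x u v w
      by (simp add: gs_def p_simps gt(3) p_in_V sum.distrib)
    show "gs x (r *\<^sub>R u) v = r * gs x u v" for x u v r
      by (simp add: gs_def p_simps gt(4) p_in_V sum_distrib_left)
    show "u = 0" if *: "\<forall>v\<in>UNIV. gs x u v = 0" for x u
    proof -
      have "p t u = 0" if t: "t \<in> I" for t
      proof (rule gt(5)[OF t p_in_V p_in_V])
        fix v assume v: "v \<in> V t"
        \<comment> \<open>A test vector from \<open>V t\<close> has zero projection to the other
          summands, so only the block of \<open>t\<close> survives and nondegeneracy of
          \<open>g t\<close> applies.\<close>
        have "gs x u v = (\<Sum>t'\<in>I. if t' = t then g t (p t x) (p t u) v else 0)"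
          unfolding gs_def using t v p_id p_other g0 p_in_V by (intro sum.cong) auto
        then show "g t (p t x) (p t u) v = 0"
          using * finite_I t by simp
      qed
      then show ?thesis
        using sum_p[of u] by simp
    qed
  qed
  show "levi_civita UNIV gs (christoffel_connection (sum_christoffel nabla))"
  proof (rule levi_civita_christoffel_connection[OF metric christoffel_symbols_sum])
    fix x v w
    let ?C = "\<lambda>t h. christoffel (nabla t) (p t x) (p t h)"
    \<comment> \<open>The block sees \<open>y\<close> only through \<open>p t y\<close>. Its
      derivative within \<open>V t\<close> is given by the Levi-Civita identity on constant fields,
      and the chain rule with \<open>p t\<close> carries it to the whole space.\<close>
    have "((\<lambda>y. g t (p t y) (p t v) (p t w)) has_derivative
        (\<lambda>h. g t (p t x) (?C t h (p t v)) (p t w) + g t (p t x) (p t v) (?C t h (p t w)))) (at x)"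
      if t: "t \<in> I" for t
    proof -
      obtain D where D: "((\<lambda>y. g t y (p t v) (p t w)) has_derivative D) (at (0 + p t x) within V t)"
        using smooth_on_derivative[OF subspace_V gt(1)[OF t p_in_V p_in_V]] p_in_V
        by (metis add_0)
      have "D (p t h) = g t (p t x) (?C t h (p t v)) (p t w) + g t (p t x) (p t v) (?C t h (p t w))"
        for h
      proof -
        have "D (p t h) = along (\<lambda>_. p t h) (\<lambda>y. g t y (p t v) (p t w)) (p t x)"
          by (rule sym, rule along_eq[OF subspace_V p_in_V]) (use D p_in_V in simp_all)
        also have "\<dots> = g t (p t x) (?C t h (p t v)) (p t w) + g t (p t x) (p t v) (?C t h (p t w))"
        proof -
          have "\<forall>X\<in>vector_fields (V t). \<forall>Y\<in>vector_fields (V t). \<forall>Z\<in>vector_fields (V t). \<forall>x\<in>V t.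
            along X (\<lambda>y. g t y (Y y) (Z y)) x =
              g t x (nabla t X Y x) (Z x) + g t x (Y x) (nabla t X Z x)"
            using lc[OF t] by (simp add: levi_civita_def)
          from bspec[OF bspec[OF bspec[OF bspec[OF this, of "\<lambda>_. p t h"], of "\<lambda>_. p t v"],
                of "\<lambda>_. p t w"], of "p t x"]
          show ?thesis
            by (simp add: christoffel_def p_in_V)
        qed
        finally show ?thesis .
      qed
      then show ?thesis
        using has_derivative_affine_comp[OF D p_linear, of UNIV] p_in_V by simp
    qed
    from has_derivative_sum[OF this]
    show "((\<lambda>y. gs y v w) has_derivative (\<lambda>u. gs x (sum_christoffel nabla x u v) w +
        gs x v (sum_christoffel nabla x u w))) (at x)"
      by (simp add: gs_def p_sum_christoffel sum.distrib)
  qed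
qed

end

section \<open>Restriction to a summand through a critical point\<close>

lemma g_convex_connection_component:
  assumes smooth: "smooth_on UNIV f" and f: "\<And>x. f x = (\<Sum>t\<in>I. fs t (p t x))"
    and convex: "g_convex_connection UNIV f" and crit: "critical_point f z" and t: "t \<in> I"
  shows "g_convex_connection (V t) (fs t)"
proof -
  obtain nabla where nabla: "connection UNIV nabla" and conv: "g_convex UNIV nabla f"
    using convex by (auto simp: g_convex_connection_def)
  obtain D H where DH: "second_order_derivatives UNIV f D H"
    and smooth_DH: "\<And>v. smooth_on UNIV (\<lambda>x. D x v)" "\<And>u v. smooth_on UNIV (\<lambda>x. H x u v)"
    using smooth_on_second_order_derivatives[OF smooth] by blast
  have fD: "\<And>x. (f has_derivative D x) (at x)"
    using DH by (auto simp: second_order_derivatives_def)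
  have C: "christoffel_symbols UNIV (christoffel nabla)"
    using christoffel_symbols_pullback[OF subspace_UNIV nabla bounded_linear_ident] by simp
  \<comment> \<open>The critical point with its component in \<open>V t\<close> removed: for
    \<open>y\<close> in \<open>V t\<close>, the point \<open>q + y\<close> has component
    \<open>y\<close> there and agrees with \<open>z\<close> in all other summands.\<close>
  define q where "q = z - p t z"
  define G where "G y u v = p t (christoffel nabla (q + y) u v)" for y u v
  have pq: "p t q = 0"
    by (simp add: q_def p_simps p_id[OF p_in_V])
  have p_t: "p s (p t x) = 0" if "s \<in> I - {t}" for s x
    using that t p_in_V by (intro p_other) auto
  have f_split: "f x = fs t (p t x) + (\<Sum>s\<in>I-{t}. fs s (p s x))" for x
    using finite_I t by (simp add: f sum.remove)
  \<comment> \<open>Displacement by \<open>w - p t w\<close> leaves the component in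
    \<open>V t\<close> unchanged, so by separability \<open>f\<close> changes along it at
    \<open>q + y\<close> exactly as it does at \<open>z\<close>.\<close>
  have f_line: "f (q + y + r *\<^sub>R (w - p t w)) = f (z + r *\<^sub>R (w - p t w)) + (fs t y - fs t (p t z))"
    if "y \<in> V t" for y w r
  proof -
    have "p s y = 0" if "s \<in> I - {t}" for s
      using that t \<open>y \<in> V t\<close> by (intro p_other) auto
    then show ?thesis
      by (simp add: f_split p_simps p_id[OF p_in_V] p_id[OF that] pq) (simp add: q_def p_simps p_t)
  qed
  \<comment> \<open>The derivative in a complementary direction is thus the same at
    \<open>q + y\<close> as at \<open>z\<close>, where it is zero.\<close>
  have D0: "D (q + y) (w - p t w) = 0" if "y \<in> V t" for y w
  proof -
    have "((\<lambda>r::real. f (q + y + r *\<^sub>R (w - p t w))) has_vector_derivative D (q + y) (w - p t w)) (at 0)"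
      by (rule has_derivative_along_line[OF subspace_UNIV _ _ fD]) auto
    moreover have "((\<lambda>r::real. f (z + r *\<^sub>R (w - p t w)) + (fs t y - fs t (p t z)))
        has_vector_derivative 0 + 0) (at 0)"
      by (intro has_vector_derivative_add has_vector_derivative_const
          has_derivative_along_line[OF subspace_UNIV, where f' = "\<lambda>_. 0"])
        (use crit in \<open>auto simp: critical_point_def\<close>)
    ultimately show ?thesis
      using vector_derivative_unique_at by (fastforce simp: f_line[OF that])
  qed
  have "second_order_derivatives (V t) (fs t) (\<lambda>y. D (q + y)) (\<lambda>y. H (q + y))"
    unfolding second_order_derivatives_def
  proof (intro ballI conjI allI)
    fix y v assume y: "y \<in> V t"
    show "bilinear (H (q + y))"
      using DH by (simp add: second_order_derivatives_def)
    have "((\<lambda>y. D (q + y) v) has_derivative (\<lambda>h. H (q + y) v h)) (at y within V t)"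
      by (rule has_derivative_affine_comp[OF _ bounded_linear_ident])
        (use DH in \<open>auto simp: second_order_derivatives_def\<close>)
    then show "((\<lambda>y. D (q + y) v) has_derivative H (q + y) v) (at y within V t)"
      by simp
    let ?c = "\<Sum>s\<in>I-{t}. fs s (p s z)"
    have "((\<lambda>y. f (q + y)) has_derivative (\<lambda>h. D (q + y) h)) (at y within V t)"
      by (rule has_derivative_affine_comp[OF _ bounded_linear_ident, where W = UNIV])
        (use fD in auto)
    then have "((\<lambda>y. f (q + y) - ?c) has_derivative D (q + y)) (at y within V t)"
      using has_derivative_diff[OF _ has_derivative_const] by fastforce
    \<comment> \<open>On \<open>V t\<close> the function \<open>fs t\<close> is a translate of
      \<open>f\<close> up to the constant contributed by the other parts at \<open>z\<close>; this
      is \<open>f_line\<close> with zero displacement.\<close>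
    moreover have "fs t y = f (q + y) - ?c" if "y \<in> V t" for y
      using f_line[OF that, of 0] by (simp add: f_split[of z])
    ultimately show "(fs t has_derivative D (q + y)) (at y within V t)"
      by (rule has_derivative_transform[OF y, rotated])
  qed
  \<comment> \<open>By \<open>D0\<close>, projecting the Christoffel vector to \<open>V t\<close>
    does not change its image under \<open>D (q + y)\<close>, so the Hessian inequality for
    \<open>f\<close> at \<open>q + y\<close> becomes the one for \<open>fs t\<close> at
    \<open>y\<close>.\<close>
  moreover have "D (q + y) (christoffel (christoffel_connection G) y v v) \<le> H (q + y) v v"
    if "y \<in> V t" for y v
    using g_convex_imp_hessian_nonneg[OF nabla conv DH smooth_DH, of "q + y" v]
      D0[OF that, of "christoffel nabla (q + y) v v"]
    by (simp add: G_def linear_diff[OF has_derivative_linear[OF fD]])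
  ultimately have "g_convex (V t) (christoffel_connection G) (fs t)"
    by (rule hessian_nonneg_imp_g_convex)
  moreover have "christoffel_symbols (V t) G"
    unfolding christoffel_symbols_def
  proof (intro conjI ballI allI)
    have "bilinear (christoffel nabla x)" for x
      using C by (simp add: christoffel_symbols_def)
    then show "bilinear (G y)" for y
      using linear_compose[OF _ bounded_linear.linear[OF p_linear]] unfolding bilinear_def G_def
      by (fastforce simp: o_def)
    show "smooth_on (V t) (\<lambda>y. G y u v)" for u v
      unfolding G_def
      by (intro smooth_on_linear_comp[OF p_linear]
          smooth_on_affine_comp[OF _ bounded_linear_ident, where W = UNIV])
        (use C in \<open>auto simp: christoffel_symbols_def\<close>)
    show "G y u v = G y v u" for y u v
      using C by (simp add: G_def christoffel_symbols_def)
    show "G y u v \<in> V t" for y u v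
      by (simp add: G_def p_in_V)
  qed
  ultimately show ?thesis
    using connection_christoffel_connection[OF subspace_V]
    unfolding g_convex_connection_def by blast
qed

end

section \<open>Coordinate subspaces of a partition and the theorem\<close>

text \<open>Each coordinate lies in exactly one block, so it is contributed exactly once by the sum
  of the projections and is killed by the projections to the other blocks.\<close>

lemma direct_sum_coord_space:
  assumes "(\<Union>t\<in>I. P t) = (UNIV :: 'n::finite set)" "disjoint_family_on P I" "finite I"
  shows "direct_sum_decomposition I (\<lambda>t. coord_space (P t)) (\<lambda>t. coord_proj (P t))"
proof (rule direct_sum_decomposition.intro)
  show "finite I"
    by fact
  fix t
  show "subspace (coord_space (P t))"
    by (auto simp: subspace_def coord_space_def)
  show "bounded_linear (coord_proj (P t))"
    by (auto intro!: linear_conv_bounded_linear[THEN iffD1] linearI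
        simp: coord_proj_def vec_eq_iff)
  fix x :: "real ^ 'n"
  show "coord_proj (P t) x \<in> coord_space (P t)"
    by (simp add: coord_space_def coord_proj_def)
  show "coord_proj (P t) x = x" if "x \<in> coord_space (P t)"
    using that by (auto simp: coord_space_def coord_proj_def vec_eq_iff)
  show "coord_proj (P t) x = 0"
    if "t \<in> I" "t' \<in> I" "t \<noteq> t'" "x \<in> coord_space (P t')" for t'
    using that assms(2) by (auto simp: coord_space_def coord_proj_def vec_eq_iff disjoint_family_on_def)
  show "(\<Sum>t\<in>I. coord_proj (P t) x) = x"
  proof (subst vec_eq_iff, rule allI)
    fix i
    obtain s where s: "s \<in> I" "i \<in> P s"
      using assms(1) by blast
    have "(\<Sum>t\<in>I. coord_proj (P t) x) $ i = (\<Sum>t\<in>I. if t = s then x $ i else 0)"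
      unfolding sum_component using s assms(2)
      by (intro sum.cong) (auto simp: coord_proj_def disjoint_family_on_def)
    then show "(\<Sum>t\<in>I. coord_proj (P t) x) $ i = x $ i"
      using assms(3) s(1) by simp
  qed
qed

theorem theorem8p2:
  fixes s :: nat
    and P :: "nat \<Rightarrow> 'n::finite set"
    and f :: "real ^ 'n \<Rightarrow> real"
    and fs :: "nat \<Rightarrow> real ^ 'n \<Rightarrow> real"
  assumes partition: "(\<Union>t\<in>{1..s}. P t) = UNIV"
      "disjoint_family_on P {1..s}"
      "\<And>t. t \<in> {1..s} \<Longrightarrow> P t \<noteq> {}"
    and smooth_parts: "\<And>t. t \<in> {1..s} \<Longrightarrow> smooth_on (coord_space (P t)) (fs t)"
    and smooth: "smooth_on UNIV f"
    and separable: "\<And>x. f x = (\<Sum>t=1..s. fs t (coord_proj (P t) x))"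
  shows "(g_convex_connection UNIV f \<longleftrightarrow>
            (\<nexists>x. critical_point f x) \<or>
            (\<forall>t\<in>{1..s}. g_convex_connection (coord_space (P t)) (fs t))) \<and>
         ((\<forall>t\<in>{1..s}. g_convex_metric (coord_space (P t)) (fs t)) \<longrightarrow>
            g_convex_metric UNIV f)"
proof -
  interpret direct_sum_decomposition "{1..s}" "\<lambda>t. coord_space (P t)" "\<lambda>t. coord_proj (P t)"
    by (rule direct_sum_coord_space) (use partition in auto)
  show ?thesis
  proof (intro conjI iffI impI)
    assume "g_convex_connection UNIV f"
    \<comment> \<open>If the first alternative fails, a single critical point serves as base point
      for all the parts at once.\<close>
    then show "(\<nexists>x. critical_point f x) \<or>
        (\<forall>t\<in>{1..s}. g_convex_connection (coord_space (P t)) (fs t))"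
      using g_convex_connection_component[OF smooth separable] by blast
  next
    assume "(\<nexists>x. critical_point f x) \<or>
      (\<forall>t\<in>{1..s}. g_convex_connection (coord_space (P t)) (fs t))"
    then show "g_convex_connection UNIV f"
    proof
      assume "\<nexists>x. critical_point f x"
      then show ?thesis
        by (rule no_critical_point_imp_g_convex_connection[OF smooth])
    next
      assume "\<forall>t\<in>{1..s}. g_convex_connection (coord_space (P t)) (fs t)"
      then obtain nabla where "\<And>t. t \<in> {1..s} \<Longrightarrow> connection (coord_space (P t)) (nabla t)"
        "\<And>t. t \<in> {1..s} \<Longrightarrow> g_convex (coord_space (P t)) (nabla t) (fs t)"
        unfolding g_convex_connection_def by metis
      then show ?thesis
        using connection_christoffel_connection[OF subspace_UNIV christoffel_symbols_sum]
          g_convex_sum[of _ f fs, OF _ separable] unfolding g_convex_connection_def by blast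
    qed
  next
    assume "\<forall>t\<in>{1..s}. g_convex_metric (coord_space (P t)) (fs t)"
    then obtain g nabla where
      H: "\<And>t. t \<in> {1..s} \<Longrightarrow> pseudo_riemannian_metric (coord_space (P t)) (g t)"
        "\<And>t. t \<in> {1..s} \<Longrightarrow> levi_civita (coord_space (P t)) (g t) (nabla t)"
        "\<And>t. t \<in> {1..s} \<Longrightarrow> g_convex (coord_space (P t)) (nabla t) (fs t)"
      unfolding g_convex_metric_def by metis
    then have C: "\<And>t. t \<in> {1..s} \<Longrightarrow> connection (coord_space (P t)) (nabla t)"
      by (simp add: levi_civita_def)
    show "g_convex_metric UNIV f"
      unfolding g_convex_metric_def
      using levi_civita_sum[OF C H(1,2)] g_convex_sum[of nabla f fs, OF C separable H(3)] by blast
  qed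
qed

end
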